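(* Let $S_n(2413,3142,P_4)$ be the set of permutations of $[n]$ (the empty permutation for $n=0$) avoiding $2413$, $3142$ and the partially ordered pattern $P_4$, and let $$F_4(x,p,q,u,v,s,t)=\sum_{n\geq 0}x^n\sum_{\sigma \in S_n(2413,3142,P_4)}p^{\mathrm{asc}(\sigma)}q^{\mathrm{des}(\sigma)}u^{\mathrm{lrmax}(\sigma)}v^{\mathrm{rlmax}(\sigma)}s^{\mathrm{lrmin}(\sigma)}t^{\mathrm{rlmin}(\sigma)}.$$ Then $F_4=F_a/F_b$, where \begin{align*} F_b =&1 + q^4 s v^3 x^4 (v - p s x) - q v x (3 + s + p x + p s x + p^2 s x^2)\\ &- q^3 v^2 x^3 \left( v - p s^2 x (2 + p x ) + s v (3 + 2 p x) \right)\\ &+ q^2 v x^2 \Big( - p s^2 x + v \left(3 + p x + s (3 + 3 p x + p^2 x^2) \right) \Big), \end{align*} \begin{align*} F_a=&1 + q^4 s v^3 x^4 \left(v - p s x + p s^2 t u (-1 + t + u - t u) v x^2 \right)+ s t u v x (1 + p t u x + p^2 t^2 u^2 x^2)\\ &+ q^2 v x^2 \Big[- p s^2 x+ s t u v^2 x \Big( 3 + p \big( 1 + 2 s (-1 + t) (-1 + u)+ t u \big) x \\ &\quad+ p^2 (-1 + t ) (-1 + u) \big( t u + s (1 + t + u + 2 t u) \big) x^2 + p^3 s (-1 + t) t (-1 + u) u x^3 \Big)\\ &\quad + v \big(3 + p x - p s^2 t^2 u^2 x^2 (2 + p x) + s (3 +3 p x + p^2 x^2) - p s^3 (-1 + t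 ) t (-1 + u ) u x^2 (1 + p^2 t u x^2 ) \big)\Big]\\ &- q^3 v^2 x^3 \Big(-p s^2 x ( 2 + p x) + s t u v^2 x \big( 1 + p s (-1 + t)(-1 + u) x +p^2 s (-1 + t) t (-1 + u) u x^2\big)\\ &\quad + v \big(1- p s^2 t^2 u^2 x^2 +s (3 + 2 p x )- p s^3 (-1 + t) t (-1 + u) u x^2 (2 + p x + p^2 t u x^2 ) \big) \Big)\\ &-q v x \Big[3 + p x + s \Big(1 + 3 t u v x + p x ( 1 + t u v x + 2 t^2 u^2 v x )+ p^2 x^2 \big(1 - t^2 (-1 + u) u^2 v x + t^3 u^2 (-1 + 2u) v x \big) \Big) \\ &\quad+ p s^2 t u x^2 \Big( p t^2 (-1 + u) v x (1 + u + p u x) - (-1 + u) v \big(1 + p (1 + u) x\big)- t \big( v + p^2 u^2 v x^2- u (-1 + v + p^2 v x^2 ) \big) \Big) \Big]. \end{align*}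
   Context: A permutation avoids a classical pattern $p$ if it has no subsequence order-isomorphic to $p$. $P_4$ is the partially ordered pattern of length 4 whose fourth element is larger than each of the first three, which are pairwise incomparable; $\pi$ avoids $P_4$ iff there are no $i_1<i_2<i_3<i_4$ with $\pi_{i_j}<\pi_{i_4}$ for $j=1,2,3$. $\mathrm{asc}$, $\mathrm{des}$ are the numbers of ascents and descents; $\mathrm{lrmax}$, $\mathrm{rlmax}$, $\mathrm{lrmin}$, $\mathrm{rlmin}$ are the numbers of left-to-right maxima, right-to-left maxima, left-to-right minima and right-to-left minima. The empty permutation contributes $1$. *)

theory Defs
  imports
    "HOL-Computational_Algebra.Formal_Power_Series"
    "HOL-Combinatorics.Multiset_Permutations"
    "HOL-Library.Sublist"
begin

(* Permutations are lists in one-line notation; positions are counted from 0. *)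

definition order_isomorphic :: "nat list \<Rightarrow> nat list \<Rightarrow> bool" where
  "order_isomorphic xs ys \<longleftrightarrow> length xs = length ys \<and>
     (\<forall>i<length xs. \<forall>j<length xs. xs ! i < xs ! j \<longleftrightarrow> ys ! i < ys ! j)"

definition avoids :: "nat list \<Rightarrow> nat list \<Rightarrow> bool" where
  "avoids \<pi> p \<longleftrightarrow> \<not> (\<exists>xs. subseq xs \<pi> \<and> order_isomorphic xs p)"

definition avoids_P4 :: "nat list \<Rightarrow> bool" where
  "avoids_P4 \<pi> \<longleftrightarrow> \<not> (\<exists>i1 i2 i3 i4. i1 < i2 \<and> i2 < i3 \<and> i3 < i4 \<and> i4 < length \<pi> \<and>
     \<pi> ! i1 < \<pi> ! i4 \<and> \<pi> ! i2 < \<pi> ! i4 \<and> \<pi> ! i3 < \<pi> ! i4)"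

definition S :: "nat \<Rightarrow> nat list set" where
  "S n = {\<sigma> \<in> permutations_of_set {1..n}.
     avoids \<sigma> [2,4,1,3] \<and> avoids \<sigma> [3,1,4,2] \<and> avoids_P4 \<sigma>}"

definition asc :: "nat list \<Rightarrow> nat" where
  "asc \<pi> = card {i. Suc i < length \<pi> \<and> \<pi> ! i < \<pi> ! Suc i}"

definition des :: "nat list \<Rightarrow> nat" where
  "des \<pi> = card {i. Suc i < length \<pi> \<and> \<pi> ! i > \<pi> ! Suc i}"

definition lrmax :: "nat list \<Rightarrow> nat" where
  "lrmax \<pi> = card {i. i < length \<pi> \<and> (\<forall>j<i. \<pi> ! j < \<pi> ! i)}"

definition rlmax :: "nat list \<Rightarrow> nat" where
  "rlmax \<pi> = card {i. i < length \<pi> \<and> (\<forall>j. i < j \<and> j < length \<pi> \<longrightarrow> \<pi> ! j < \<pi> ! i)}"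

definition lrmin :: "nat list \<Rightarrow> nat" where
  "lrmin \<pi> = card {i. i < length \<pi> \<and> (\<forall>j<i. \<pi> ! j > \<pi> ! i)}"

definition rlmin :: "nat list \<Rightarrow> nat" where
  "rlmin \<pi> = card {i. i < length \<pi> \<and> (\<forall>j. i < j \<and> j < length \<pi> \<longrightarrow> \<pi> ! j > \<pi> ! i)}"

(* The variable x is the formal variable of the power series; p, q, u, v, s, t are arbitrary
   elements of an arbitrary coefficient ring. Taking the coefficients to be the rational functions
   in six indeterminates gives the seven-variable series. *)
definition F4 :: "'a::comm_ring_1 \<Rightarrow> 'a \<Rightarrow> 'a \<Rightarrow> 'a \<Rightarrow> 'a \<Rightarrow> 'a \<Rightarrow> 'a fps" where
  "F4 p q u v s t = Abs_fps (\<lambda>n. \<Sum>\<sigma>\<in>S n.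
     p ^ asc \<sigma> * q ^ des \<sigma> * u ^ lrmax \<sigma> * v ^ rlmax \<sigma> * s ^ lrmin \<sigma> * t ^ rlmin \<sigma>)"

definition Fb :: "'a::comm_ring_1 \<Rightarrow> 'a \<Rightarrow> 'a \<Rightarrow> 'a \<Rightarrow> 'a \<Rightarrow> 'a" where
  "Fb x p q v s =
     1 + q^4 * s * v^3 * x^4 * (v - p * s * x)
     - q * v * x * (3 + s + p * x + p * s * x + p^2 * s * x^2)
     - q^3 * v^2 * x^3 * (v - p * s^2 * x * (2 + p * x) + s * v * (3 + 2 * p * x))
     + q^2 * v * x^2 * (- (p * s^2 * x)
         + v * (3 + p * x + s * (3 + 3 * p * x + p^2 * x^2)))"

definition Fa :: "'a::comm_ring_1 \<Rightarrow> 'a \<Rightarrow> 'a \<Rightarrow> 'a \<Rightarrow> 'a \<Rightarrow> 'a \<Rightarrow> 'a \<Rightarrow> 'a" where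
  "Fa x p q u v s t =
     1 + q^4 * s * v^3 * x^4 * (v - p * s * x
         + p * s^2 * t * u * (-1 + t + u - t * u) * v * x^2)
     + s * t * u * v * x * (1 + p * t * u * x + p^2 * t^2 * u^2 * x^2)
     + q^2 * v * x^2 * (- (p * s^2 * x)
         + s * t * u * v^2 * x * (3
             + p * (1 + 2 * s * (-1 + t) * (-1 + u) + t * u) * x
             + p^2 * (-1 + t) * (-1 + u) * (t * u + s * (1 + t + u + 2 * t * u)) * x^2
             + p^3 * s * (-1 + t) * t * (-1 + u) * u * x^3)
         + v * (3 + p * x - p * s^2 * t^2 * u^2 * x^2 * (2 + p * x)
             + s * (3 + 3 * p * x + p^2 * x^2)
             - p * s^3 * (-1 + t) * t * (-1 + u) * u * x^2 * (1 + p^2 * t * u * x^2)))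
     - q^3 * v^2 * x^3 * (- (p * s^2 * x * (2 + p * x))
         + s * t * u * v^2 * x * (1 + p * s * (-1 + t) * (-1 + u) * x
             + p^2 * s * (-1 + t) * t * (-1 + u) * u * x^2)
         + v * (1 - p * s^2 * t^2 * u^2 * x^2 + s * (3 + 2 * p * x)
             - p * s^3 * (-1 + t) * t * (-1 + u) * u * x^2
                 * (2 + p * x + p^2 * t * u * x^2)))
     - q * v * x * (3 + p * x
         + s * (1 + 3 * t * u * v * x
             + p * x * (1 + t * u * v * x + 2 * t^2 * u^2 * v * x)
             + p^2 * x^2 * (1 - t^2 * (-1 + u) * u^2 * v * x
                 + t^3 * u^2 * (-1 + 2 * u) * v * x))
         + p * s^2 * t * u * x^2 * (p * t^2 * (-1 + u) * v * x * (1 + u + p * u * x)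
             - (-1 + u) * v * (1 + p * (1 + u) * x)
             - t * (v + p^2 * u^2 * v * x^2 - u * (-1 + v + p^2 * v * x^2))))"

end

theory Submission
  imports Defs
begin

text \<open>
  Call an entry of a permutation k-bounded if at most k smaller entries precede it; avoiding \<open>P\<^sub>4\<close>
  means that all entries are 2-bounded. Each permutation is uniquely a skew sum of skew-indecomposable
  blocks, and a skew sum lies in the class of k-bounded separable permutations iff its blocks do.
  Looking at the position of the entry 1, the blocks of this class for k \<le> 2 are found to be \<open>1\<close>,
  \<open>1 \<oplus> \<beta>\<close> with \<open>\<beta>\<close> in the class for k - 1, and, for k = 2 only, \<open>21 \<oplus> \<beta>\<close> with \<open>\<beta>\<close> decreasing.
  Under a skew sum ascents, right-to-left maxima and left-to-right minima add up, descents add up with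
  one more per junction, only the first block carries left-to-right maxima and only the last one
  right-to-left minima. Writing \<open>E(u,t)\<close> for the series of nonempty permutations and \<open>B(u,t)\<close> for that
  of blocks, this gives \<open>E(u,t) = B(u,t) + q B(u,1) E(1,t)\<close>, which determines the series for
  k = 0, 1, 2 in turn.
\<close>

unbundle fps_syntax

subsection \<open>Statistics of concatenations\<close>

text \<open>All six statistics count positions. The range is cut at \<open>length xs\<close> for
  maxima and minima of \<open>xs @ ys\<close>, and after the first position for ascents and
  descents.\<close>

lemma card_index_split:
  "card {i. i < m + n \<and> P i} = card {i. i < m \<and> P i} + card {i::nat. i < n \<and> P (m + i)}"
proof -
  have "{i. i < m + n \<and> P i} = {i. i < m \<and> P i} \<union> (+) m ` {i. i < n \<and> P (m + i)}"
  proof (intro equalityI subsetI)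
    fix i assume i: "i \<in> {i. i < m + n \<and> P i}"
    show "i \<in> {i. i < m \<and> P i} \<union> (+) m ` {i. i < n \<and> P (m + i)}"
    proof (cases "i < m")
      case False
      with i have "i = m + (i - m)" "i - m \<in> {i. i < n \<and> P (m + i)}" by auto
      then show ?thesis by blast
    qed (use i in auto)
  qed auto
  also have "card \<dots> = card {i. i < m \<and> P i} + card ((+) m ` {i. i < n \<and> P (m + i)})"
    by (rule card_Un_disjoint) auto
  also have "card ((+) m ` {i. i < n \<and> P (m + i)}) = card {i. i < n \<and> P (m + i)}"
    by (rule card_image) simp
  finally show ?thesis .
qed

lemma less_add_iff_cases:
  "(\<forall>j < m + i. P j) \<longleftrightarrow> (\<forall>j < m. P j) \<and> (\<forall>j < i. P (m + (j::nat)))"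
  (is "?l \<longleftrightarrow> ?r")
proof
  assume r: ?r
  show ?l
  proof (intro allI impI)
    fix j assume "j < m + i"
    then show "P j" using r by (cases "j < m") (auto dest: spec[of _ "j - m"])
  qed
qed auto

lemma greater_add_iff_cases:
  "(\<forall>j. i < j \<and> j < m + n \<longrightarrow> P j) \<longleftrightarrow>
     (\<forall>j. i < j \<and> j < m \<longrightarrow> P j) \<and> (\<forall>j < n. i < m + j \<longrightarrow> P (m + (j::nat)))"
  using less_add_iff_cases[of m n "\<lambda>j. i < j \<longrightarrow> P j"] by blast

text \<open>A left-to-right maximum depends only on what stands before it, so those of
  \<open>xs\<close> survive, while an entry of \<open>ys\<close> must also beat all of
  \<open>xs\<close>. The same holds for \<open>lrmin\<close>; for \<open>rlmax\<close> and
  \<open>rlmin\<close> the two parts exchange roles.\<close>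

lemma lrmax_append:
  "lrmax (xs @ ys) = lrmax xs +
     card {i. i < length ys \<and> (\<forall>x \<in> set xs. x < ys ! i) \<and> (\<forall>j<i. ys ! j < ys ! i)}"
proof -
  have "{i. i < length xs \<and> (\<forall>j<i. (xs @ ys) ! j < (xs @ ys) ! i)} =
      {i. i < length xs \<and> (\<forall>j<i. xs ! j < xs ! i)}"
    by (auto simp: nth_append)
  moreover have "(\<forall>j<length xs + i. (xs @ ys) ! j < (xs @ ys) ! (length xs + i)) \<longleftrightarrow>
      (\<forall>x \<in> set xs. x < ys ! i) \<and> (\<forall>j<i. ys ! j < ys ! i)" for i
    unfolding less_add_iff_cases all_set_conv_all_nth by (simp add: nth_append)
  ultimately show ?thesis by (simp add: lrmax_def card_index_split)
qed

lemma lrmin_append: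
  "lrmin (xs @ ys) = lrmin xs +
     card {i. i < length ys \<and> (\<forall>x \<in> set xs. x > ys ! i) \<and> (\<forall>j<i. ys ! j > ys ! i)}"
proof -
  have "{i. i < length xs \<and> (\<forall>j<i. (xs @ ys) ! j > (xs @ ys) ! i)} =
      {i. i < length xs \<and> (\<forall>j<i. xs ! j > xs ! i)}"
    by (auto simp: nth_append)
  moreover have "(\<forall>j<length xs + i. (xs @ ys) ! j > (xs @ ys) ! (length xs + i)) \<longleftrightarrow>
      (\<forall>x \<in> set xs. x > ys ! i) \<and> (\<forall>j<i. ys ! j > ys ! i)" for i
    unfolding less_add_iff_cases all_set_conv_all_nth by (simp add: nth_append)
  ultimately show ?thesis by (simp add: lrmin_def card_index_split)
qed

lemma rlmax_append:
  "rlmax (xs @ ys) = rlmax ys +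
     card {i. i < length xs \<and> (\<forall>j. i < j \<and> j < length xs \<longrightarrow> xs ! j < xs ! i) \<and>
       (\<forall>y \<in> set ys. y < xs ! i)}"
proof -
  have "(\<forall>j. i < j \<and> j < length xs + length ys \<longrightarrow> (xs @ ys) ! j < (xs @ ys) ! i) \<longleftrightarrow>
      (\<forall>j. i < j \<and> j < length xs \<longrightarrow> xs ! j < xs ! i) \<and> (\<forall>y \<in> set ys. y < xs ! i)"
    if "i < length xs" for i
    unfolding greater_add_iff_cases all_set_conv_all_nth using that by (auto simp: nth_append)
  then have "{i. i < length xs \<and>
        (\<forall>j. i < j \<and> j < length xs + length ys \<longrightarrow> (xs @ ys) ! j < (xs @ ys) ! i)} =
      {i. i < length xs \<and> (\<forall>j. i < j \<and> j < length xs \<longrightarrow> xs ! j < xs ! i) \<and>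
        (\<forall>y \<in> set ys. y < xs ! i)}"
    by blast
  moreover have "(\<forall>j. length xs + i < j \<and> j < length xs + length ys \<longrightarrow>
        (xs @ ys) ! j < (xs @ ys) ! (length xs + i)) \<longleftrightarrow>
      (\<forall>j. i < j \<and> j < length ys \<longrightarrow> ys ! j < ys ! i)" for i
    unfolding greater_add_iff_cases by (auto simp: nth_append)
  ultimately show ?thesis by (simp add: rlmax_def card_index_split)
qed

lemma rlmin_append:
  "rlmin (xs @ ys) = rlmin ys +
     card {i. i < length xs \<and> (\<forall>j. i < j \<and> j < length xs \<longrightarrow> xs ! j > xs ! i) \<and>
       (\<forall>y \<in> set ys. y > xs ! i)}"
proof -
  have "(\<forall>j. i < j \<and> j < length xs + length ys \<longrightarrow> (xs @ ys) ! j > (xs @ ys) ! i) \<longleftrightarrow>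
      (\<forall>j. i < j \<and> j < length xs \<longrightarrow> xs ! j > xs ! i) \<and> (\<forall>y \<in> set ys. y > xs ! i)"
    if "i < length xs" for i
    unfolding greater_add_iff_cases all_set_conv_all_nth using that by (auto simp: nth_append)
  then have "{i. i < length xs \<and>
        (\<forall>j. i < j \<and> j < length xs + length ys \<longrightarrow> (xs @ ys) ! j > (xs @ ys) ! i)} =
      {i. i < length xs \<and> (\<forall>j. i < j \<and> j < length xs \<longrightarrow> xs ! j > xs ! i) \<and>
        (\<forall>y \<in> set ys. y > xs ! i)}"
    by blast
  moreover have "(\<forall>j. length xs + i < j \<and> j < length xs + length ys \<longrightarrow>
        (xs @ ys) ! j > (xs @ ys) ! (length xs + i)) \<longleftrightarrow>
      (\<forall>j. i < j \<and> j < length ys \<longrightarrow> ys ! j > ys ! i)" for i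
    unfolding greater_add_iff_cases by (auto simp: nth_append)
  ultimately show ?thesis by (simp add: rlmin_def card_index_split)
qed

section \<open>Ascents and descents across a junction\<close>

lemma asc_Nil [simp]: "asc [] = 0" and des_Nil [simp]: "des [] = 0"
  and asc_single [simp]: "asc [x] = 0" and des_single [simp]: "des [x] = 0"
  by (simp_all add: asc_def des_def)

lemma asc_Cons: "ys \<noteq> [] \<Longrightarrow> asc (x # ys) = of_bool (x < hd ys) + asc ys"
proof (induction ys)
  case (Cons y zs)
  have *: "{i. i < 1 \<and> (x # y # zs) ! i < (x # y # zs) ! Suc i} = (if x < y then {0} else {})"
    by auto
  \<comment> \<open>There are \<open>1 + length zs\<close> adjacent pairs; splitting off one of them
    isolates the pair \<open>x\<close>, \<open>y\<close>.\<close>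
  have "asc (x # y # zs) =
      card {i. i < 1 + length zs \<and> (x # y # zs) ! i < (x # y # zs) ! Suc i}"
    by (simp add: asc_def)
  also have "\<dots> = of_bool (x < y) + asc (y # zs)"
    unfolding card_index_split * by (simp add: asc_def)
  finally show ?case by simp
qed simp

lemma des_Cons: "ys \<noteq> [] \<Longrightarrow> des (x # ys) = of_bool (x > hd ys) + des ys"
proof (induction ys)
  case (Cons y zs)
  have *: "{i. i < 1 \<and> (x # y # zs) ! i > (x # y # zs) ! Suc i} = (if x > y then {0} else {})"
    by auto
  have "des (x # y # zs) =
      card {i. i < 1 + length zs \<and> (x # y # zs) ! i > (x # y # zs) ! Suc i}"
    by (simp add: des_def)
  also have "\<dots> = of_bool (x > y) + des (y # zs)"
    unfolding card_index_split * by (simp add: des_def)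
  finally show ?case by simp
qed simp

lemma asc_append:
  "xs \<noteq> [] \<Longrightarrow> ys \<noteq> [] \<Longrightarrow> asc (xs @ ys) = asc xs + of_bool (last xs < hd ys) + asc ys"
  by (induction xs rule: list_nonempty_induct) (simp_all add: asc_Cons)

lemma des_append:
  "xs \<noteq> [] \<Longrightarrow> ys \<noteq> [] \<Longrightarrow> des (xs @ ys) = des xs + of_bool (last xs > hd ys) + des ys"
  by (induction xs rule: list_nonempty_induct) (simp_all add: des_Cons)

lemma statistics_map_add [simp]:
  "asc (map ((+) c) xs) = asc xs" "des (map ((+) c) xs) = des xs"
  "lrmax (map ((+) c) xs) = lrmax xs" "rlmax (map ((+) c) xs) = rlmax xs"
  "lrmin (map ((+) c) xs) = lrmin xs" "rlmin (map ((+) c) xs) = rlmin xs"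
  by (auto simp: asc_def des_def lrmax_def rlmax_def lrmin_def rlmin_def
      intro!: arg_cong[where f = card])

lemma statistics_single [simp]:
  "lrmax [x] = 1" "rlmax [x] = 1" "lrmin [x] = 1" "rlmin [x] = 1"
  by (simp_all add: lrmax_def rlmax_def lrmin_def rlmin_def cong: conj_cong)

text \<open>The junction is a descent. Since both parts are nonempty, no entry of \<open>ys\<close>
  is a left-to-right maximum and no entry of \<open>xs\<close> a right-to-left minimum; the
  conditions across the junction for \<open>rlmax\<close> and \<open>lrmin\<close> hold
  automatically.\<close>

lemma statistics_append_greater:
  assumes "xs \<noteq> []" "ys \<noteq> []" "\<And>x y. x \<in> set xs \<Longrightarrow> y \<in> set ys \<Longrightarrow> y < x"
  shows "asc (xs @ ys) = asc xs + asc ys" "des (xs @ ys) = Suc (des xs + des ys)"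
    "lrmax (xs @ ys) = lrmax xs" "rlmax (xs @ ys) = rlmax xs + rlmax ys"
    "lrmin (xs @ ys) = lrmin xs + lrmin ys" "rlmin (xs @ ys) = rlmin ys"
proof -
  have *: "hd ys < last xs" using assms by simp
  show "asc (xs @ ys) = asc xs + asc ys" "des (xs @ ys) = Suc (des xs + des ys)"
    using * assms(1,2) by (simp_all add: asc_append des_append)
  have "\<not> (\<forall>x \<in> set xs. x < ys ! i)" if "i < length ys" for i
    using assms that by (metis hd_in_set nth_mem order.asym)
  then show "lrmax (xs @ ys) = lrmax xs" by (simp add: lrmax_append cong: conj_cong)
  have "\<not> (\<forall>y \<in> set ys. y > xs ! i)" if "i < length xs" for i
    using assms that by (metis hd_in_set nth_mem order.asym)
  then show "rlmin (xs @ ys) = rlmin ys" by (simp add: rlmin_append cong: conj_cong)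
  have "\<forall>y \<in> set ys. y < xs ! i" if "i < length xs" for i using assms that by simp
  then show "rlmax (xs @ ys) = rlmax xs + rlmax ys"
    by (simp add: rlmax_append rlmax_def[of xs] cong: conj_cong)
  have "\<forall>x \<in> set xs. x > ys ! i" if "i < length ys" for i using assms that by simp
  then show "lrmin (xs @ ys) = lrmin xs + lrmin ys"
    by (simp add: lrmin_append lrmin_def[of ys] cong: conj_cong)
qed

text \<open>Reversing the order of values turns this into the previous situation, with ascents and
  descents as well as maxima and minima exchanged.\<close>

lemma statistics_append_less:
  assumes "xs \<noteq> []" "ys \<noteq> []" "\<And>x y. x \<in> set xs \<Longrightarrow> y \<in> set ys \<Longrightarrow> x < y"
  shows "asc (xs @ ys) = Suc (asc xs + asc ys)" "des (xs @ ys) = des xs + des ys"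
    "lrmax (xs @ ys) = lrmax xs + lrmax ys" "rlmax (xs @ ys) = rlmax ys"
    "lrmin (xs @ ys) = lrmin xs" "rlmin (xs @ ys) = rlmin xs + rlmin ys"
proof -
  have *: "last xs < hd ys" using assms by simp
  show "asc (xs @ ys) = Suc (asc xs + asc ys)" "des (xs @ ys) = des xs + des ys"
    using * assms(1,2) by (simp_all add: asc_append des_append)
  have "\<not> (\<forall>x \<in> set xs. x > ys ! i)" if "i < length ys" for i
    using assms that by (metis hd_in_set nth_mem order.asym)
  then show "lrmin (xs @ ys) = lrmin xs" by (simp add: lrmin_append cong: conj_cong)
  have "\<not> (\<forall>y \<in> set ys. y < xs ! i)" if "i < length xs" for i
    using assms that by (metis hd_in_set nth_mem order.asym)
  then show "rlmax (xs @ ys) = rlmax ys" by (simp add: rlmax_append cong: conj_cong)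
  have "\<forall>y \<in> set ys. y > xs ! i" if "i < length xs" for i using assms that by simp
  then show "rlmin (xs @ ys) = rlmin xs + rlmin ys"
    by (simp add: rlmin_append rlmin_def[of xs] cong: conj_cong)
  have "\<forall>x \<in> set xs. x < ys ! i" if "i < length ys" for i using assms that by simp
  then show "lrmax (xs @ ys) = lrmax xs + lrmax ys"
    by (simp add: lrmax_append lrmax_def[of ys] cong: conj_cong)
qed

subsection \<open>Separable permutations with few smaller entries to the left\<close>

text \<open>The two chains of inequalities are the order types 2413 and 3142, in a form suited to
  arguments about subsequences.\<close>

definition separable :: "nat list \<Rightarrow> bool" where
  "separable \<sigma> \<longleftrightarrow> (\<forall>a b c d. subseq [a, b, c, d] \<sigma> \<longrightarrow>
     \<not> (c < a \<and> a < d \<and> d < b) \<and> \<not> (b < d \<and> d < a \<and> a < c))"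

text \<open>The bound is a parameter because deleting a first entry below all others lowers it by
  one. For lists with distinct entries, \<open>k = 0\<close> means decreasing.\<close>

definition smaller_left_bounded :: "nat \<Rightarrow> nat list \<Rightarrow> bool" where
  "smaller_left_bounded k \<sigma> \<longleftrightarrow>
     (\<forall>xs d. subseq (xs @ [d]) \<sigma> \<longrightarrow> (\<forall>x \<in> set xs. x < d) \<longrightarrow> length xs \<le> k)"

definition bounded_separable :: "nat \<Rightarrow> nat list \<Rightarrow> bool" where
  "bounded_separable k \<sigma> \<longleftrightarrow> separable \<sigma> \<and> smaller_left_bounded k \<sigma>"

section \<open>From pattern avoidance to conditions on subsequences\<close>

lemma separableD:
  assumes "separable \<sigma>" "subseq [a, b, c, d] \<sigma>"
  shows "c < a \<Longrightarrow> a < d \<Longrightarrow> d < b \<Longrightarrow> False" "b < d \<Longrightarrow> d < a \<Longrightarrow> a < c \<Longrightarrow> False"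
  using assms unfolding separable_def by blast+

lemma length4E:
  assumes "length xs = 4"
  obtains a b c d where "xs = [a, b, c, d]"
  using assms by (auto simp: length_Suc_conv eval_nat_numeral)

text \<open>Order isomorphism preserves length, so only lists of four letters matter, and for these
  it amounts to finitely many comparisons.\<close>

lemma avoids_2413:
  "avoids \<sigma> [2,4,1,3] \<longleftrightarrow> \<not> (\<exists>a b c d. subseq [a, b, c, d] \<sigma> \<and> c < a \<and> a < d \<and> d < b)"
proof -
  have "order_isomorphic [a, b, c, d] [2,4,1,3] \<longleftrightarrow> c < a \<and> a < d \<and> d < b" for a b c d
    by (auto simp: order_isomorphic_def All_less_Suc)
  moreover have "order_isomorphic xs [2,4,1,3] \<Longrightarrow> length xs = 4" for xs
    by (simp add: order_isomorphic_def)
  ultimately show ?thesis unfolding avoids_def by (metis length4E)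
qed

lemma avoids_3142:
  "avoids \<sigma> [3,1,4,2] \<longleftrightarrow> \<not> (\<exists>a b c d. subseq [a, b, c, d] \<sigma> \<and> b < d \<and> d < a \<and> a < c)"
proof -
  have "order_isomorphic [a, b, c, d] [3,1,4,2] \<longleftrightarrow> b < d \<and> d < a \<and> a < c" for a b c d
    by (auto simp: order_isomorphic_def All_less_Suc)
  moreover have "order_isomorphic xs [3,1,4,2] \<Longrightarrow> length xs = 4" for xs
    by (simp add: order_isomorphic_def)
  ultimately show ?thesis unfolding avoids_def by (metis length4E)
qed

lemma subseq_Cons_conv: "subseq (x # xs) ys \<longleftrightarrow> (\<exists>us vs. ys = us @ x # vs \<and> subseq xs vs)"
  using list_emb_ConsD[of "(=)" x xs ys] by auto

lemma subseq_Cons_Cons: "subseq (x # xs) (y # ys) \<Longrightarrow> subseq xs ys"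
  by (cases "x = y") (auto dest: subseq_Cons2_neq subseq_Cons')

text \<open>This links \<open>avoids_P4\<close>, which speaks of positions, with the conditions on
  subsequences. In one direction the positions are read off from the lengths of the gaps between the
  letters.\<close>

lemma subseq_4_conv_nth:
  "subseq [a, b, c, d] \<sigma> \<longleftrightarrow> (\<exists>i1 i2 i3 i4. i1 < i2 \<and> i2 < i3 \<and> i3 < i4 \<and> i4 < length \<sigma> \<and>
     a = \<sigma> ! i1 \<and> b = \<sigma> ! i2 \<and> c = \<sigma> ! i3 \<and> d = \<sigma> ! i4)"
proof
  assume "subseq [a, b, c, d] \<sigma>"
  then obtain us vs ws xs ys where \<sigma>: "\<sigma> = us @ a # vs @ b # ws @ c # xs @ d # ys"
    by (auto simp: subseq_Cons_conv)
  let ?i1 = "length us" let ?i2 = "?i1 + 1 + length vs"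
  let ?i3 = "?i2 + 1 + length ws" let ?i4 = "?i3 + 1 + length xs"
  have "a = \<sigma> ! ?i1" "b = \<sigma> ! ?i2" "c = \<sigma> ! ?i3" "d = \<sigma> ! ?i4" "?i4 < length \<sigma>"
    by (simp_all add: \<sigma> nth_append)
  then show "\<exists>i1 i2 i3 i4. i1 < i2 \<and> i2 < i3 \<and> i3 < i4 \<and> i4 < length \<sigma> \<and>
     a = \<sigma> ! i1 \<and> b = \<sigma> ! i2 \<and> c = \<sigma> ! i3 \<and> d = \<sigma> ! i4"
    by (intro exI[of _ ?i1] exI[of _ ?i2] exI[of _ ?i3] exI[of _ ?i4]) auto
next
  \<comment> \<open>In the other direction the letters are placed from left to right: what remains
    lies in the suffix behind the last chosen position.\<close>
  have drop: "subseq (\<sigma> ! i # zs) (drop m \<sigma>)"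
    if "m \<le> i" "i < length \<sigma>" "subseq zs (drop (Suc i) \<sigma>)" for m i zs
  proof -
    have "drop m \<sigma> = take (i - m) (drop m \<sigma>) @ \<sigma> ! i # drop (Suc i) \<sigma>"
      using that(1,2) by (metis Cons_nth_drop_Suc append_take_drop_id drop_drop le_add_diff_inverse2)
    then show ?thesis using that(3) subseq_Cons_conv by metis
  qed
  assume "\<exists>i1 i2 i3 i4. i1 < i2 \<and> i2 < i3 \<and> i3 < i4 \<and> i4 < length \<sigma> \<and>
     a = \<sigma> ! i1 \<and> b = \<sigma> ! i2 \<and> c = \<sigma> ! i3 \<and> d = \<sigma> ! i4"
  then obtain i1 i2 i3 i4 where i: "i1 < i2" "i2 < i3" "i3 < i4" "i4 < length \<sigma>"
    and "a = \<sigma> ! i1" "b = \<sigma> ! i2" "c = \<sigma> ! i3" "d = \<sigma> ! i4" by blast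
  have "subseq [a, b, c, d] (drop 0 \<sigma>)"
    unfolding \<open>a = _\<close> \<open>b = _\<close> \<open>c = _\<close> \<open>d = _\<close> using i by (intro drop) auto
  then show "subseq [a, b, c, d] \<sigma>" by simp
qed

lemma avoids_P4_iff: "avoids_P4 \<sigma> \<longleftrightarrow> smaller_left_bounded 2 \<sigma>"
proof -
  have "avoids_P4 \<sigma> \<longleftrightarrow> \<not> (\<exists>a b c d. subseq [a, b, c, d] \<sigma> \<and> a < d \<and> b < d \<and> c < d)"
    unfolding avoids_P4_def subseq_4_conv_nth by blast
  also have "\<dots> \<longleftrightarrow> smaller_left_bounded 2 \<sigma>"
  proof
    assume "smaller_left_bounded 2 \<sigma>"
    then have "length [a, b, c] \<le> 2"
      if "subseq ([a, b, c] @ [d]) \<sigma>" "\<forall>x \<in> set [a, b, c]. x < d" for a b c d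
      using that unfolding smaller_left_bounded_def by blast
    then show "\<not> (\<exists>a b c d. subseq [a, b, c, d] \<sigma> \<and> a < d \<and> b < d \<and> c < d)"
      by fastforce
  next
    assume *: "\<not> (\<exists>a b c d. subseq [a, b, c, d] \<sigma> \<and> a < d \<and> b < d \<and> c < d)"
    show "smaller_left_bounded 2 \<sigma>"
      unfolding smaller_left_bounded_def
    proof (intro allI impI, rule ccontr)
      fix xs d assume xs: "subseq (xs @ [d]) \<sigma>" "\<forall>x \<in> set xs. x < d" "\<not> length xs \<le> 2"
      \<comment> \<open>Three of the smaller entries are enough for an occurrence of the pattern;
        the surplus \<open>zs\<close> is skipped.\<close>
      then obtain a b c zs where [simp]: "xs = a # b # c # zs"
        by (auto simp: not_le Suc_le_eq[symmetric] Suc_le_length_iff eval_nat_numeral)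
      have "subseq [a, b, c, d] (xs @ [d])" by (simp add: subseq_drop_many)
      then have "subseq [a, b, c, d] \<sigma>" using xs(1) by (rule subseq_order.trans)
      with * xs(2) show False by auto
    qed
  qed
  finally show ?thesis .
qed

definition perms :: "nat \<Rightarrow> nat list set" where
  "perms n = permutations_of_set {1..n}"

definition bsep :: "nat \<Rightarrow> nat \<Rightarrow> nat list set" where
  "bsep k n = {\<sigma> \<in> perms n. bounded_separable k \<sigma>}"

lemma S_eq_bsep: "S n = bsep 2 n"
proof -
  have "avoids \<sigma> [2,4,1,3] \<and> avoids \<sigma> [3,1,4,2] \<longleftrightarrow> separable \<sigma>" for \<sigma>
    unfolding avoids_2413 avoids_3142 separable_def
    by (intro iffI allI impI conjI notI; elim conjE exE; blast)
  then show ?thesis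
    by (auto simp: S_def bsep_def perms_def bounded_separable_def avoids_P4_iff)
qed

subsection \<open>Direct and skew sums\<close>

definition skew_sum :: "nat list \<Rightarrow> nat list \<Rightarrow> nat list" where
  "skew_sum \<alpha> \<beta> = map ((+) (length \<beta>)) \<alpha> @ \<beta>"

definition direct_sum :: "nat list \<Rightarrow> nat list \<Rightarrow> nat list" where
  "direct_sum \<alpha> \<beta> = \<alpha> @ map ((+) (length \<alpha>)) \<beta>"

lemma perms_iff: "\<sigma> \<in> perms n \<longleftrightarrow> set \<sigma> = {1..n} \<and> distinct \<sigma>"
  by (simp add: perms_def permutations_of_set_def)

lemma length_perms: "\<sigma> \<in> perms n \<Longrightarrow> length \<sigma> = n"
  by (simp add: perms_def length_finite_permutations_of_set)

lemma finite_bsep [simp]: "finite (bsep k n)"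
  by (simp add: bsep_def perms_def)

lemma subseq_map_conv: "subseq zs (map f xs) \<longleftrightarrow> (\<exists>ys. subseq ys xs \<and> zs = map f ys)"
  unfolding subseq_conv_nths nths_map by blast

lemma bounded_separable_map_add [simp]:
  "bounded_separable k (map ((+) c) xs) \<longleftrightarrow> bounded_separable k xs"
proof -
  have "separable (map ((+) c) xs) \<longleftrightarrow> separable xs"
  proof
    assume *: "separable xs"
    show "separable (map ((+) c) xs)"
      unfolding separable_def subseq_map_conv
    proof (intro allI impI; elim exE conjE)
      fix a b c' d zs assume "subseq zs xs" "[a, b, c', d] = map ((+) c) zs"
      then obtain a1 b1 c1 d1 where
        "subseq [a1, b1, c1, d1] xs" "a = c + a1" "b = c + b1" "c' = c + c1" "d = c + d1"
        by (auto simp: Cons_eq_map_conv)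
      moreover from this(1) have "\<not> (c1 < a1 \<and> a1 < d1 \<and> d1 < b1) \<and> \<not> (b1 < d1 \<and> d1 < a1 \<and> a1 < c1)"
        using * unfolding separable_def by blast
      ultimately show "\<not> (c' < a \<and> a < d \<and> d < b) \<and> \<not> (b < d \<and> d < a \<and> a < c')"
        by simp
    qed
  next
    assume *: "separable (map ((+) c) xs)"
    show "separable xs"
      unfolding separable_def
    proof (intro allI impI)
      fix a b c' d assume "subseq [a, b, c', d] xs"
      then have "subseq [c + a, c + b, c + c', c + d] (map ((+) c) xs)"
        using subseq_map[of "[a, b, c', d]" xs "(+) c"] by simp
      then show "\<not> (c' < a \<and> a < d \<and> d < b) \<and> \<not> (b < d \<and> d < a \<and> a < c')"
        using * unfolding separable_def by (metis add_less_cancel_left)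
    qed
  qed
  moreover have "smaller_left_bounded k (map ((+) c) xs) \<longleftrightarrow> smaller_left_bounded k xs"
  proof
    assume *: "smaller_left_bounded k xs"
    show "smaller_left_bounded k (map ((+) c) xs)"
      unfolding smaller_left_bounded_def subseq_map_conv
      using * by (auto simp: append_eq_map_conv Cons_eq_map_conv smaller_left_bounded_def)
  next
    assume *: "smaller_left_bounded k (map ((+) c) xs)"
    show "smaller_left_bounded k xs"
      unfolding smaller_left_bounded_def
    proof (intro allI impI)
      fix zs d assume "subseq (zs @ [d]) xs" "\<forall>x\<in>set zs. x < d"
      then have "subseq (map ((+) c) zs @ [c + d]) (map ((+) c) xs)"
        "\<forall>x\<in>set (map ((+) c) zs). x < c + d"
        using subseq_map[of "zs @ [d]" xs "(+) c"] by simp_all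
      then have "length (map ((+) c) zs) \<le> k"
        using * unfolding smaller_left_bounded_def by blast
      then show "length zs \<le> k" by simp
    qed
  qed
  ultimately show ?thesis by (simp add: bounded_separable_def)
qed

section \<open>Behaviour of the class under subsequences and sums\<close>

lemma smaller_left_bounded_subseq:
  "smaller_left_bounded k ys \<Longrightarrow> subseq xs ys \<Longrightarrow> smaller_left_bounded k xs"
  unfolding smaller_left_bounded_def using subseq_order.trans[of _ xs ys] by blast

lemma separable_subseq: "separable ys \<Longrightarrow> subseq xs ys \<Longrightarrow> separable xs"
  unfolding separable_def using subseq_order.trans[of _ xs ys] by blast

lemma subseq_set: "subseq xs ys \<Longrightarrow> x \<in> set xs \<Longrightarrow> x \<in> set ys"
  by (erule list_emb_set) auto

text \<open>Neither 2413 nor 3142 can be cut so that the left part lies above the right part, so an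
  occurrence stays inside \<open>xs\<close> or inside \<open>ys\<close>. Likewise all smaller
  entries to the left of an entry of \<open>ys\<close> belong to \<open>ys\<close>.\<close>

lemma bounded_separable_skew:
  assumes "\<And>x y. x \<in> set xs \<Longrightarrow> y \<in> set ys \<Longrightarrow> y < x"
  shows "bounded_separable k (xs @ ys) \<longleftrightarrow> bounded_separable k xs \<and> bounded_separable k ys"
proof
  assume "bounded_separable k (xs @ ys)"
  moreover have "subseq xs (xs @ ys)" "subseq ys (xs @ ys)" by auto
  ultimately show "bounded_separable k xs \<and> bounded_separable k ys"
    unfolding bounded_separable_def by (meson smaller_left_bounded_subseq separable_subseq)
next
  assume *: "bounded_separable k xs \<and> bounded_separable k ys"
  show "bounded_separable k (xs @ ys)"
    unfolding bounded_separable_def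
  proof
    have "\<not> (c < a \<and> a < d \<and> d < b) \<and> \<not> (b < d \<and> d < a \<and> a < c)"
      if "subseq [a, b, c, d] (xs @ ys)" for a b c d
    proof -
      from that obtain us vs where uv: "[a, b, c, d] = us @ vs" "subseq us xs" "subseq vs ys"
        by (auto simp: subseq_append_iff)
      have less: "v < u" if "u \<in> set us" "v \<in> set vs" for u v
        using assms[OF subseq_set[OF uv(2) that(1)] subseq_set[OF uv(3) that(2)]] .
      consider "us = []" | "vs = []" | "us = [a]" "vs = [b,c,d]" | "us = [a,b]" "vs = [c,d]"
        | "us = [a,b,c]" "vs = [d]"
        using uv(1) by (auto simp: Cons_eq_append_conv)
      then show ?thesis
      proof cases
        case 1
        then have "subseq [a, b, c, d] ys" using uv by simp
        then show ?thesis using * unfolding bounded_separable_def separable_def by blast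
      next
        case 2
        then have "subseq [a, b, c, d] xs" using uv by simp
        then show ?thesis using * unfolding bounded_separable_def separable_def by blast
      next
        case 3 then show ?thesis using less[of a b] less[of a c] less[of a d] by auto
      next
        case 4 then show ?thesis using less[of a d] less[of b d] less[of a c] by auto
      next
        case 5 then show ?thesis using less[of a d] less[of b d] less[of c d] by auto
      qed
    qed
    then show "separable (xs @ ys)" unfolding separable_def by blast
    show "smaller_left_bounded k (xs @ ys)"
      unfolding smaller_left_bounded_def
    proof (intro allI impI)
      fix zs d assume zs: "subseq (zs @ [d]) (xs @ ys)" "\<forall>x \<in> set zs. x < d"
      then obtain us vs where uv: "zs @ [d] = us @ vs" "subseq us xs" "subseq vs ys"
        by (auto simp: subseq_append_iff)
      show "length zs \<le> k"
      proof (cases vs rule: rev_cases)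
        case Nil
        then have "subseq (zs @ [d]) xs" using uv by simp
        then show ?thesis using * zs(2)
          unfolding bounded_separable_def smaller_left_bounded_def by blast
      next
        case (snoc vs' d')
        then have [simp]: "d' = d" "zs = us @ vs'" using uv(1) by simp_all
        have d: "d \<in> set ys" using subseq_set[OF uv(3)] snoc by simp
        \<comment> \<open>A letter of \<open>us\<close> would be smaller than \<open>d\<close>,
          although it lies in \<open>xs\<close> and \<open>d\<close> in \<open>ys\<close>.\<close>
        have "us = []"
        proof (cases us)
          case (Cons w ws)
          then have "w \<in> set xs" "w < d" using subseq_set[OF uv(2)] zs(2) by simp_all
          then show ?thesis using assms[OF _ d] by fastforce
        qed
        then have "subseq (zs @ [d]) ys" using uv(3) snoc by simp
        then show ?thesis using * zs(2)
          unfolding bounded_separable_def smaller_left_bounded_def by blast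
      qed
    qed
  qed
qed

text \<open>The new first entry is one more smaller entry to the left of every other entry. It
  starts no occurrence of 2413 or 3142, because in both the first letter has a smaller one behind
  it.\<close>

lemma bounded_separable_Cons:
  assumes "\<And>y. y \<in> set ys \<Longrightarrow> x < y"
  shows "bounded_separable (Suc k) (x # ys) \<longleftrightarrow> bounded_separable k ys"
proof
  assume "bounded_separable (Suc k) (x # ys)"
  then have *: "separable (x # ys)" "smaller_left_bounded (Suc k) (x # ys)"
    by (auto simp: bounded_separable_def)
  have "length zs \<le> k" if "subseq (zs @ [d]) ys" "\<forall>x\<in>set zs. x < d" for zs d
  proof -
    have "d \<in> set ys" using that(1) by (rule subseq_set) simp
    then have "\<forall>x\<in>set (x # zs). x < d" using assms that by simp
    moreover have "subseq ((x # zs) @ [d]) (x # ys)" using that by simp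
    ultimately have "length (x # zs) \<le> Suc k"
      using *(2) unfolding smaller_left_bounded_def by blast
    then show ?thesis by simp
  qed
  then show "bounded_separable k ys"
    using separable_subseq[OF *(1), of ys] by (auto simp: bounded_separable_def smaller_left_bounded_def)
next
  assume "bounded_separable k ys"
  then have *: "separable ys" "smaller_left_bounded k ys"
    by (auto simp: bounded_separable_def)
  have "separable (x # ys)"
    unfolding separable_def
  proof (intro allI impI)
    fix a b c d assume abcd: "subseq [a, b, c, d] (x # ys)"
    show "\<not> (c < a \<and> a < d \<and> d < b) \<and> \<not> (b < d \<and> d < a \<and> a < c)"
    proof (cases "a = x")
      case True
      with abcd have "subseq [b, c, d] ys" by simp
      then have "c \<in> set ys" "d \<in> set ys" by (auto intro: subseq_set)
      then show ?thesis using assms True by fastforce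
    next
      case False
      then have "subseq [a, b, c, d] ys" using abcd by (metis subseq_Cons2_neq)
      then show ?thesis using *(1) unfolding separable_def by blast
    qed
  qed
  moreover have "length zs \<le> Suc k" if "subseq (zs @ [d]) (x # ys)" "\<forall>x\<in>set zs. x < d" for zs d
  proof (cases zs)
    case (Cons z zs')
    have "subseq (z # zs' @ [d]) (x # ys)" using that(1) unfolding Cons append_Cons .
    \<comment> \<open>Dropping the first letter leaves a subsequence of \<open>ys\<close>, whether
      or not that letter was matched with \<open>x\<close>.\<close>
    then have "subseq (zs' @ [d]) ys" by (rule subseq_Cons_Cons)
    moreover have "\<forall>x\<in>set zs'. x < d" using that(2) Cons by simp
    ultimately have "length zs' \<le> k" using *(2) unfolding smaller_left_bounded_def by blast
    then show ?thesis using Cons by simp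
  qed simp
  ultimately show "bounded_separable (Suc k) (x # ys)"
    unfolding bounded_separable_def smaller_left_bounded_def by blast
qed

text \<open>Both leading entries lie below all of \<open>ys\<close> and so use up the bound 2 there.
  The only entry below \<open>x'\<close> stands directly behind it, whereas 2413 and 3142 need a
  letter below the first one in third or fourth place.\<close>

lemma bounded_separable_Cons2:
  assumes "\<And>y. y \<in> set ys \<Longrightarrow> x' < y" "x < x'"
  shows "bounded_separable 2 (x' # x # ys) \<longleftrightarrow> bounded_separable 0 ys"
proof
  assume "bounded_separable 2 (x' # x # ys)"
  then have *: "separable (x' # x # ys)" "smaller_left_bounded 2 (x' # x # ys)"
    by (auto simp: bounded_separable_def)
  have "length zs \<le> 0" if "subseq (zs @ [d]) ys" "\<forall>x\<in>set zs. x < d" for zs d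
  proof -
    have "d \<in> set ys" using that(1) by (rule subseq_set) simp
    then have "\<forall>x\<in>set (x' # x # zs). x < d" using assms that by fastforce
    moreover have "subseq ((x' # x # zs) @ [d]) (x' # x # ys)" using that by simp
    ultimately have "length (x' # x # zs) \<le> 2"
      using *(2) unfolding smaller_left_bounded_def by blast
    then show ?thesis by simp
  qed
  then show "bounded_separable 0 ys"
    using separable_subseq[OF *(1), of ys]
    unfolding bounded_separable_def smaller_left_bounded_def by auto
next
  assume 0: "bounded_separable 0 ys"
  then have "bounded_separable 1 (x # ys)" 
    using bounded_separable_Cons[of ys x 0] assms by fastforce
  then have *: "separable (x # ys)" "smaller_left_bounded 1 (x # ys)"
    by (auto simp: bounded_separable_def)
  have "separable (x' # x # ys)"
    unfolding separable_def
  proof (intro allI impI)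
    fix a b c d assume abcd: "subseq [a, b, c, d] (x' # x # ys)"
    show "\<not> (c < a \<and> a < d \<and> d < b) \<and> \<not> (b < d \<and> d < a \<and> a < c)"
    proof (cases "a = x'")
      case True
      with abcd have "subseq [b, c, d] (x # ys)" by simp
      \<comment> \<open>The letter \<open>b\<close> takes at least the place of \<open>x\<close>, so
        \<open>c\<close> and \<open>d\<close> come from \<open>ys\<close> and exceed
        \<open>x'\<close>.\<close>
      then have "subseq [c, d] ys" by (rule subseq_Cons_Cons)
      then have "c \<in> set ys" "d \<in> set ys" by (auto intro: subseq_set)
      then show ?thesis using assms True by fastforce
    next
      case False
      then have "subseq [a, b, c, d] (x # ys)" using abcd by (metis subseq_Cons2_neq)
      then show ?thesis using *(1) unfolding separable_def by blast
    qed
  qed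
  moreover have "length zs \<le> 2" if "subseq (zs @ [d]) (x' # x # ys)" "\<forall>x\<in>set zs. x < d" for zs d
  proof (cases zs)
    case (Cons z zs')
    have "subseq (z # zs' @ [d]) (x' # x # ys)" using that(1) unfolding Cons append_Cons .
    then have "subseq (zs' @ [d]) (x # ys)" by (rule subseq_Cons_Cons)
    moreover have "\<forall>x\<in>set zs'. x < d" using that(2) Cons by simp
    ultimately have "length zs' \<le> 1" using *(2) unfolding smaller_left_bounded_def by blast
    then show ?thesis using Cons by simp
  qed simp
  ultimately show "bounded_separable 2 (x' # x # ys)"
    unfolding bounded_separable_def smaller_left_bounded_def by blast
qed

subsection \<open>Skew-indecomposable blocks\<close>

text \<open>Formulated for arbitrary lists, so that it applies directly to a shifted block inside a
  longer permutation.\<close>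

definition skew_indecomposable :: "nat list \<Rightarrow> bool" where
  "skew_indecomposable \<sigma> \<longleftrightarrow> \<sigma> \<noteq> [] \<and>
     (\<forall>xs ys. \<sigma> = xs @ ys \<longrightarrow> xs \<noteq> [] \<longrightarrow> ys \<noteq> [] \<longrightarrow> \<not> (\<forall>x \<in> set xs. \<forall>y \<in> set ys. y < x))"

definition ibsep :: "nat \<Rightarrow> nat \<Rightarrow> nat list set" where
  "ibsep k n = {\<sigma> \<in> bsep k n. skew_indecomposable \<sigma>}"

lemma finite_ibsep [simp]: "finite (ibsep k n)"
  by (simp add: ibsep_def)

lemma skew_indecomposableE:
  assumes "skew_indecomposable \<sigma>" "\<sigma> = xs @ ys" "xs \<noteq> []" "ys \<noteq> []"
  obtains x y where "x \<in> set xs" "y \<in> set ys" "x \<le> y"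
proof -
  have "\<not> (\<forall>x \<in> set xs. \<forall>y \<in> set ys. y < x)"
    using assms unfolding skew_indecomposable_def by blast
  then show ?thesis using that by (auto simp: not_less)
qed

text \<open>Every cut into nonempty parts leaves the head on the left and the last entry on the
  right.\<close>

lemma skew_indecomposable_if_hd_less_last:
  assumes "\<sigma> \<noteq> []" "hd \<sigma> < last \<sigma>"
  shows "skew_indecomposable \<sigma>"
  unfolding skew_indecomposable_def
proof (intro conjI allI impI notI)
  fix xs ys assume "\<sigma> = xs @ ys" "xs \<noteq> []" "ys \<noteq> []" "\<forall>x\<in>set xs. \<forall>y\<in>set ys. y < x"
  then have "last \<sigma> < hd \<sigma>" by simp
  with assms show False by simp
qed (use assms in simp)

text \<open>A value below the maximum of \<open>A\<close> but missing from \<open>A\<close> would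
  lie in \<open>B\<close>, hence above that maximum. So \<open>A\<close> is an initial segment and
  \<open>B\<close> the rest, which is what allows summands to be normalised to permutations.\<close>

lemma interval_split:
  assumes "A \<union> B = {1..n::nat}" "\<And>a b. a \<in> A \<Longrightarrow> b \<in> B \<Longrightarrow> a < b"
  shows "A = {1..card A}" "B = (+) (card A) ` {1..card B}"
proof -
  have fin: "finite A" "finite B" using assms(1) by (metis finite_Un finite_atLeastAtMost)+
  have "\<exists>m \<le> n. A = {1..m}"
  proof (cases "A = {}")
    case True then show ?thesis by (intro exI[of _ 0]) auto
  next
    case False
    define m where "m = Max A"
    have m: "m \<in> A" using False fin by (simp add: m_def)
    have "x \<in> A" if "x \<in> {1..m}" for x
    proof (rule ccontr)
      assume "x \<notin> A"
      moreover have "m \<in> {1..n}" using m assms(1) by blast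
      then have "x \<in> A \<union> B" using that unfolding assms(1) by simp
      ultimately have "m < x" using assms(2) m by blast
      then show False using that by simp
    qed
    moreover have "x \<in> {1..m}" if "x \<in> A" for x
    proof -
      have "x \<in> {1..n}" using that assms(1) by blast
      then show ?thesis using that fin by (simp add: m_def)
    qed
    ultimately have "A = {1..m}" by blast
    moreover have "m \<in> {1..n}" using m assms(1) by blast
    then have "m \<le> n" by simp
    ultimately show ?thesis by blast
  qed
  then obtain m where m: "m \<le> n" "A = {1..m}" by blast
  then show "A = {1..card A}" by simp
  have "A \<inter> B = {}" using assms(2) by blast
  then have "B = {1..n} - {1..m}" using assms(1) m by blast
  also have "\<dots> = {m + 1..m + (n - m)}" using m by auto
  finally have B: "B = {m + 1..m + (n - m)}" .
  then show "B = (+) (card A) ` {1..card B}" using m by (simp add: add.commute)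
qed

lemma unshift_perm:
  assumes "distinct ys" "set ys = (+) k ` {1..length ys}"
  obtains \<beta> where "\<beta> \<in> perms (length ys)" "ys = map ((+) k) \<beta>"
proof
  \<comment> \<open>Truncated subtraction is safe here: every entry of \<open>ys\<close> is at least
    \<open>k + 1\<close>.\<close>
  let ?\<beta> = "map (\<lambda>y. y - k) ys"
  have "map ((+) k) ?\<beta> = map (\<lambda>y. y) ys"
    unfolding map_map by (rule map_cong) (use assms(2) in auto)
  then show *: "ys = map ((+) k) ?\<beta>" by simp
  have "set ?\<beta> = (\<lambda>y. y - k) ` (+) k ` {1..length ys}" using assms(2) by simp
  also have "\<dots> = {1..length ys}" unfolding image_image by simp
  finally show "?\<beta> \<in> perms (length ys)"
    using * assms(1) by (metis distinct_map perms_iff)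
qed

lemma perms_append_less:
  assumes "xs @ ys \<in> perms n" "\<And>x y. x \<in> set xs \<Longrightarrow> y \<in> set ys \<Longrightarrow> x < y"
  obtains \<beta> where "xs \<in> perms (length xs)" "\<beta> \<in> perms (length ys)" "xs @ ys = direct_sum xs \<beta>"
proof -
  have d: "set xs \<union> set ys = {1..n}" "distinct xs" "distinct ys"
    using assms(1) by (simp_all add: perms_iff)
  then have c: "card (set xs) = length xs" "card (set ys) = length ys"
    by (simp_all add: distinct_card)
  note s = interval_split[OF d(1) assms(2), unfolded c]
  have "set ys = (+) (length xs) ` {1..length ys}" using s(2) by blast
  then obtain \<beta> where "\<beta> \<in> perms (length ys)" "ys = map ((+) (length xs)) \<beta>"
    using unshift_perm d(3) by blast
  moreover have "xs \<in> perms (length xs)" using s(1) d(2) unfolding perms_iff by blast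
  ultimately show ?thesis using that by (simp add: direct_sum_def)
qed

lemma perms_append_greater:
  assumes "xs @ ys \<in> perms n" "\<And>x y. x \<in> set xs \<Longrightarrow> y \<in> set ys \<Longrightarrow> y < x"
  obtains \<alpha> where "\<alpha> \<in> perms (length xs)" "ys \<in> perms (length ys)" "xs @ ys = skew_sum \<alpha> ys"
proof -
  have d: "set ys \<union> set xs = {1..n}" "distinct xs" "distinct ys"
    using assms(1) by (auto simp: perms_iff)
  then have c: "card (set xs) = length xs" "card (set ys) = length ys"
    by (simp_all add: distinct_card)
  note s = interval_split[OF d(1) assms(2), unfolded c]
  have "set xs = (+) (length ys) ` {1..length xs}" using s(2) by blast
  then obtain \<alpha> where "\<alpha> \<in> perms (length xs)" "xs = map ((+) (length ys)) \<alpha>"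
    using unshift_perm d(2) by blast
  moreover have "ys \<in> perms (length ys)" using s(1) d(3) unfolding perms_iff by blast
  ultimately show ?thesis using that by (simp add: skew_sum_def)
qed

lemma skew_sum_greater:
  "\<alpha> \<in> perms m \<Longrightarrow> \<beta> \<in> perms n \<Longrightarrow> x \<in> set (map ((+) (length \<beta>)) \<alpha>) \<Longrightarrow> y \<in> set \<beta> \<Longrightarrow> y < x"
  by (auto simp: length_perms) (auto simp: perms_iff)

lemma perms_shift:
  "\<alpha> \<in> perms m \<Longrightarrow> set (map ((+) c) \<alpha>) = {c + 1..c + m} \<and> distinct (map ((+) c) \<alpha>)"
  by (simp add: perms_iff distinct_map add.commute)

lemma skew_sum_perms:
  assumes "\<alpha> \<in> perms m" "\<beta> \<in> perms n"
  shows "skew_sum \<alpha> \<beta> \<in> perms (m + n)"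
  using perms_shift[OF assms(1), of n] assms(2)
  by (auto simp: skew_sum_def length_perms[OF assms(2)] perms_iff)

lemma direct_sum_perms:
  assumes "\<alpha> \<in> perms m" "\<beta> \<in> perms n"
  shows "direct_sum \<alpha> \<beta> \<in> perms (m + n)"
  using perms_shift[OF assms(2), of m] assms(1)
  by (auto simp: direct_sum_def length_perms[OF assms(1)] perms_iff)

lemma skew_indecomposable_map_add [simp]:
  "skew_indecomposable (map ((+) c) \<sigma>) \<longleftrightarrow> skew_indecomposable \<sigma>"
proof -
  have "(\<forall>xs ys. map ((+) c) \<sigma> = xs @ ys \<longrightarrow> Q xs ys) \<longleftrightarrow>
      (\<forall>xs ys. \<sigma> = xs @ ys \<longrightarrow> Q (map ((+) c) xs) (map ((+) c) ys))" for Q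
    by (auto simp: map_eq_append_conv)
  then show ?thesis unfolding skew_indecomposable_def by simp
qed

text \<open>The first block is the shortest nonempty prefix whose entries exceed everything behind
  it. The remainder \<beta> may be empty, namely when the whole permutation is one block.\<close>

lemma skew_sum_bij:
  assumes "n > 0"
  shows "bij_betw (\<lambda>(m, \<alpha>, \<beta>). skew_sum \<alpha> \<beta>)
    (SIGMA m:{1..n}. ibsep k m \<times> bsep k (n - m)) (bsep k n)"
  (is "bij_betw ?f ?D _")
  unfolding bij_betw_def
proof
  show "inj_on ?f ?D"
  proof (rule inj_onI, clarsimp)
    fix m \<alpha> \<beta> m' \<alpha>' \<beta>'
    assume m: "Suc 0 \<le> m" "m \<le> n" "Suc 0 \<le> m'" "m' \<le> n"
      and \<alpha>: "\<alpha> \<in> ibsep k m" "\<beta> \<in> bsep k (n - m)" and \<alpha>': "\<alpha>' \<in> ibsep k m'" "\<beta>' \<in> bsep k (n - m')"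
      and eq: "skew_sum \<alpha> \<beta> = skew_sum \<alpha>' \<beta>'"
    \<comment> \<open>If \<open>m < m'\<close>, the end of the shorter block cuts the longer one:
      the part of \<open>?zs\<close> behind position \<open>m\<close> consists of entries of
      \<beta>, all below \<open>?xs\<close>.\<close>
    have not_less: "\<not> m < m'"
      if m: "Suc 0 \<le> m" "m \<le> n" "Suc 0 \<le> m'" "m' \<le> n"
        and \<alpha>: "\<alpha> \<in> ibsep k m" "\<beta> \<in> bsep k (n - m)"
        and \<alpha>': "\<alpha>' \<in> ibsep k m'" "\<beta>' \<in> bsep k (n - m')"
        and eq: "skew_sum \<alpha> \<beta> = skew_sum \<alpha>' \<beta>'" for m \<alpha> \<beta> m' \<alpha>' \<beta>'
    proof
      assume "m < m'"
      let ?xs = "map ((+) (length \<beta>)) \<alpha>" and ?zs = "map ((+) (length \<beta>')) \<alpha>'"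
      have P: "\<alpha> \<in> perms m" "\<beta> \<in> perms (n - m)" "\<alpha>' \<in> perms m'"
        using \<alpha> \<alpha>' by (auto simp: ibsep_def bsep_def)
      have len: "length ?xs = m" "length ?zs = m'" using P by (simp_all add: length_perms)
      have "take m ?zs = take m (?zs @ \<beta>')" using \<open>m < m'\<close> len by simp
      also have "\<dots> = take m (?xs @ \<beta>)" using eq by (simp add: skew_sum_def)
      also have "\<dots> = ?xs" using len by simp
      finally have t: "take m ?zs = ?xs" .
      have "drop m ?zs @ \<beta>' = drop m (?zs @ \<beta>')" using \<open>m < m'\<close> len by simp
      also have "\<dots> = drop m (?xs @ \<beta>)" using eq by (simp add: skew_sum_def)
      also have "\<dots> = \<beta>" using len by simp
      finally have "set (drop m ?zs) \<subseteq> set \<beta>" by auto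
      moreover have "skew_indecomposable ?zs" using \<alpha>' by (simp add: ibsep_def)
      moreover have "?zs = ?xs @ drop m ?zs" using t by (metis append_take_drop_id)
      moreover have "?xs \<noteq> []" "drop m ?zs \<noteq> []" using len m \<open>m < m'\<close> by auto
      ultimately show False
        using skew_sum_greater[OF P(1,2)] by (metis linorder_not_less skew_indecomposableE subsetD)
    qed
    have "m = m'" using not_less[OF m \<alpha> \<alpha>' eq] not_less[OF m(3,4,1,2) \<alpha>' \<alpha> eq[symmetric]] by simp
    moreover have "length \<alpha> = m" "length \<beta> = n - m" "length \<alpha>' = m'" "length \<beta>' = n - m'"
      using \<alpha> \<alpha>' by (auto simp: ibsep_def bsep_def length_perms)
    ultimately show "m = m' \<and> \<alpha> = \<alpha>' \<and> \<beta> = \<beta>'" using eq by (auto simp: skew_sum_def)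
  qed
  show "?f ` ?D = bsep k n"
  proof (intro equalityI subsetI)
    fix \<sigma> assume "\<sigma> \<in> ?f ` ?D"
    then obtain m \<alpha> \<beta> where m: "m \<le> n" and \<alpha>: "\<alpha> \<in> ibsep k m" "\<beta> \<in> bsep k (n - m)"
      and \<sigma>: "\<sigma> = skew_sum \<alpha> \<beta>" by auto
    then have P: "\<alpha> \<in> perms m" "\<beta> \<in> perms (n - m)" by (auto simp: ibsep_def bsep_def)
    then have "\<sigma> \<in> perms n" using skew_sum_perms[OF P] m \<sigma> by simp
    moreover have "bounded_separable k \<sigma>"
      unfolding \<sigma> skew_sum_def
      by (subst bounded_separable_skew[OF skew_sum_greater[OF P]])
        (use \<alpha> in \<open>auto simp: ibsep_def bsep_def\<close>)
    ultimately show "\<sigma> \<in> bsep k n" by (simp add: bsep_def)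
  next
    fix \<sigma> assume \<sigma>: "\<sigma> \<in> bsep k n"
    then have P: "\<sigma> \<in> perms n" by (simp add: bsep_def)
    define Q where "Q m \<longleftrightarrow> m > 0 \<and> (\<forall>x \<in> set (take m \<sigma>). \<forall>y \<in> set (drop m \<sigma>). y < x)" for m
    define m where "m = (LEAST m. Q m)"
    \<comment> \<open>The whole list qualifies, since nothing stands behind it; hence the least such
      \<open>m\<close> exists.\<close>
    have Qn: "Q n" using assms length_perms[OF P] by (simp add: Q_def)
    then have Q: "Q m" and m: "m \<le> n" unfolding m_def by (auto intro: LeastI Least_le)
    let ?xs = "take m \<sigma>" and ?\<beta> = "drop m \<sigma>"
    have len: "length ?xs = m" "length ?\<beta> = n - m" using m length_perms[OF P] by simp_all
    have gr: "\<And>x y. x \<in> set ?xs \<Longrightarrow> y \<in> set ?\<beta> \<Longrightarrow> y < x" using Q by (auto simp: Q_def)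
    have "?xs @ ?\<beta> \<in> perms n" using P by simp
    then obtain \<alpha> where \<alpha>: "\<alpha> \<in> perms (length ?xs)" "?\<beta> \<in> perms (length ?\<beta>)"
        "?xs @ ?\<beta> = skew_sum \<alpha> ?\<beta>"
      using gr by (rule perms_append_greater)
    then have xs: "?xs = map ((+) (length ?\<beta>)) \<alpha>" unfolding skew_sum_def append_same_eq by blast
    have good: "bounded_separable k ?xs" "bounded_separable k ?\<beta>"
      using \<sigma> bounded_separable_skew[of ?xs ?\<beta> k, OF gr] by (simp_all add: bsep_def)
    have "skew_indecomposable ?xs"
      unfolding skew_indecomposable_def
    proof (intro conjI allI impI notI)
      fix as bs assume ab: "?xs = as @ bs" "as \<noteq> []" "bs \<noteq> []" "\<forall>x\<in>set as. \<forall>y\<in>set bs. y < x"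
      have s: "\<sigma> = as @ bs @ ?\<beta>" using ab(1) by (metis append.assoc append_take_drop_id)
      have td: "take (length as) \<sigma> = as" "drop (length as) \<sigma> = bs @ ?\<beta>"
        using s by (metis append_eq_conv_conj)+
      \<comment> \<open>A cut inside the prefix would give a shorter prefix with the defining
        property, against the choice of \<open>m\<close>.\<close>
      have "Q (length as)"
        unfolding Q_def
      proof (intro conjI ballI)
        fix x y assume "x \<in> set (take (length as) \<sigma>)" "y \<in> set (drop (length as) \<sigma>)"
        then have "x \<in> set as" "y \<in> set bs \<union> set ?\<beta>" unfolding td by simp_all
        moreover have "x \<in> set ?xs" using calculation(1) unfolding ab(1) by simp
        ultimately show "y < x" using ab(4) gr by blast
      qed (use ab in simp)
      then have "m \<le> length as" unfolding m_def by (rule Least_le)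
      moreover have "length as + length bs = m" using len(1) ab(1) by simp
      ultimately have "length bs = 0" by linarith
      then show False using ab(3) by simp
    next
      assume "?xs = []" then show False using len Q by (simp add: Q_def)
    qed
    then have "\<alpha> \<in> ibsep k m" "?\<beta> \<in> bsep k (n - m)"
      using good \<alpha> len unfolding xs by (simp_all add: ibsep_def bsep_def)
    moreover have "\<sigma> = ?f (m, \<alpha>, ?\<beta>)" using \<alpha>(3) by simp
    moreover have "m \<in> {1..n}" using m Q by (simp add: Q_def)
    ultimately show "\<sigma> \<in> ?f ` ?D" by blast
  qed
qed

section \<open>Direct sums beginning with 1 or 21, and the classification of blocks\<close>

lemma perms_1_21: "[1] \<in> perms 1" "[2, 1] \<in> perms 2"
  by (auto simp: perms_iff)

lemma direct_sum_less:
  "\<alpha> \<in> perms m \<Longrightarrow> \<beta> \<in> perms n \<Longrightarrow> x \<in> set \<alpha> \<Longrightarrow> y \<in> set (map ((+) (length \<alpha>)) \<beta>) \<Longrightarrow> x < y"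
  by (auto simp: length_perms) (auto simp: perms_iff)

lemma direct_sum_indecomposable:
  assumes "\<alpha> \<in> perms m" "\<beta> \<in> perms n" "\<alpha> \<noteq> []" "\<beta> \<noteq> []"
  shows "skew_indecomposable (direct_sum \<alpha> \<beta>)"
proof (rule skew_indecomposable_if_hd_less_last)
  show "hd (direct_sum \<alpha> \<beta>) < last (direct_sum \<alpha> \<beta>)"
    using direct_sum_less[OF assms(1,2), of "hd \<alpha>" "last (map ((+) (length \<alpha>)) \<beta>)"] assms(3,4)
    by (simp add: direct_sum_def last_map)
qed (use assms in \<open>simp add: direct_sum_def\<close>)

lemma bounded_separable_direct_sum_1:
  assumes "\<beta> \<in> perms n"
  shows "bounded_separable (Suc k) (direct_sum [1] \<beta>) \<longleftrightarrow> bounded_separable k \<beta>"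
  using bounded_separable_Cons[of "map ((+) 1) \<beta>" 1 k] direct_sum_less[OF perms_1_21(1) assms]
    bounded_separable_map_add[of k 1 \<beta>]
  by (simp add: direct_sum_def)

lemma bounded_separable_direct_sum_21:
  assumes "\<beta> \<in> perms n"
  shows "bounded_separable 2 (direct_sum [2, 1] \<beta>) \<longleftrightarrow> bounded_separable 0 \<beta>"
  using bounded_separable_Cons2[of "map ((+) 2) \<beta>" 2 1] direct_sum_less[OF perms_1_21(2) assms, of 2]
    bounded_separable_map_add[of 0 2 \<beta>]
  by (simp add: direct_sum_def numeral_2_eq_2)

lemma subseq_mem_append: "x \<in> set us \<Longrightarrow> subseq xs vs \<Longrightarrow> subseq (x # xs) (us @ vs)"
  using list_emb_append_mono[of "(=)" "[x]" us xs vs] by (simp add: subseq_singleton_left)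

text \<open>The entry 1 has to come first, unless some entry on its left lies below an entry on its right.
  In that case 1 and the least entry on its left use up the bound 2 for all entries on its right.\<close>

lemma indecomposable_cases:
  assumes P: "\<sigma> \<in> perms n" and bs: "bounded_separable k \<sigma>" and ind: "skew_indecomposable \<sigma>"
    and k: "k \<le> 2"
  obtains "\<sigma> = [1]"
  | j \<beta> where "k = Suc j" "\<beta> \<in> bsep j (n - 1)" "\<beta> \<noteq> []" "\<sigma> = direct_sum [1] \<beta>"
  | \<beta> where "k = 2" "\<beta> \<in> bsep 0 (n - 2)" "\<beta> \<noteq> []" "\<sigma> = direct_sum [2, 1] \<beta>"
proof -
  have ne: "\<sigma> \<noteq> []" using ind by (simp add: skew_indecomposable_def)
  have len: "length \<sigma> = n" using P by (rule length_perms)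
  have dist: "distinct \<sigma>" and set: "set \<sigma> = {1..n}" using P by (simp_all add: perms_iff)
  have sep: "separable \<sigma>" and bd: "smaller_left_bounded k \<sigma>"
    using bs by (simp_all add: bounded_separable_def)
  have "1 \<in> set \<sigma>" using ne set by (metis Suc_leI atLeastAtMost_iff le_numeral_extra(4) len length_greater_0_conv One_nat_def)
  then obtain L R where \<sigma>: "\<sigma> = L @ 1 # R" by (meson split_list)
  have gt1: "1 < x" if "x \<in> set L \<union> set R" for x
  proof -
    have "x \<noteq> 1" using that dist \<sigma> by auto
    moreover have "x \<in> {1..n}" using that \<sigma> unfolding set[symmetric] by auto
    ultimately show ?thesis by simp
  qed
  have bdD: "length xs \<le> k" if "subseq (xs @ [d]) \<sigma>" "\<forall>x\<in>set xs. x < d" for xs d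
    using bd that unfolding smaller_left_bounded_def by blast
  show ?thesis
  proof (cases "L = []")
    case True
    show ?thesis
    proof (cases "R = []")
      case True
      then show ?thesis using \<open>L = []\<close> \<sigma> that(1) by simp
    next
      case False
      have "[1] @ R \<in> perms n" using P \<sigma> True by simp
      then obtain \<beta> where \<beta>: "\<beta> \<in> perms (length R)" "[1] @ R = direct_sum [1] \<beta>"
        by (rule perms_append_less) (use gt1 in auto)
      have s: "\<sigma> = direct_sum [1] \<beta>" using \<beta> \<sigma> True by simp
      have lR: "length R = n - 1" using len \<sigma> True by simp
      obtain r rs where R: "R = r # rs" using False by (cases R) auto
      have "length [1::nat] \<le> k"
      proof (rule bdD)
        show "subseq ([1] @ [r]) \<sigma>" using \<sigma> R True by simp
        show "\<forall>x\<in>set [1]. x < r" using gt1[of r] R by simp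
      qed
      then obtain j where j: "k = Suc j" by (cases k) auto
      have "bounded_separable j \<beta>"
        using bs bounded_separable_direct_sum_1[OF \<beta>(1)] unfolding s j by simp
      then have "\<beta> \<in> bsep j (n - 1)" using \<beta>(1) lR by (simp add: bsep_def)
      moreover have "\<beta> \<noteq> []" using \<beta>(1) False by (auto dest: length_perms)
      ultimately show ?thesis using that(2) j s by blast
    qed
  next
    case False
    \<comment> \<open>The cut just before the entry 1 cannot be a skew cut. This yields
      \<open>y\<close> above some entry of \<open>L\<close>, and \<open>y\<close> is not 1.\<close>
    have "\<sigma> = L @ (1 # R)" using \<sigma> by simp
    then obtain x y where xy: "x \<in> set L" "y \<in> set (1 # R)" "x \<le> y"
      by (rule skew_indecomposableE[OF ind]) (use False in auto)
    have y: "y \<in> set R" using xy gt1[of x] by auto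
    define l where "l = Min (set L)"
    have l: "l \<in> set L" and lmin: "\<And>z. z \<in> set L \<Longrightarrow> l \<le> z" using False by (simp_all add: l_def)
    have "x \<noteq> y" using dist \<sigma> xy(1) y by auto
    then have ly: "l < y" using lmin[OF xy(1)] xy(3) by simp
    obtain L1 L2 where L: "L = L1 @ l # L2" using l by (meson split_list)
    obtain R1 R2 where R: "R = R1 @ y # R2" using y by (meson split_list)
    have subL: "subseq (us @ 1 # vs) \<sigma>" if "subseq us L" "subseq vs R" for us vs
      unfolding \<sigma> using that by (intro list_emb_append_mono) auto
    have "length [l, 1] \<le> k"
    proof (rule bdD)
      show "subseq ([l, 1] @ [y]) \<sigma>" using subL[of "[l]" "[y]"] l y by (simp add: subseq_singleton_left)
      show "\<forall>x\<in>set [l, 1]. x < y" using ly gt1[of y] y by simp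
    qed
    then have k2: "k = 2" using k by simp
    have no3: False if "subseq [a, b, c, d] \<sigma>" "a < d" "b < d" "c < d" for a b c d
      using bdD[of "[a, b, c]" d] that k2 by simp
    \<comment> \<open>An \<open>r\<close> below \<open>l\<close> standing before \<open>y\<close>
      gives three smaller entries \<open>l\<close>, \<open>1\<close>, \<open>r\<close> before
      \<open>y\<close>; standing after \<open>y\<close> it makes \<open>l\<close>, \<open>1\<close>,
      \<open>y\<close>, \<open>r\<close> a 3142.\<close>
    have lR: "l < r" if r: "r \<in> set R" for r
    proof (rule ccontr)
      assume "\<not> l < r"
      moreover have "r \<noteq> l" using dist \<sigma> r l by auto
      ultimately have rl: "r < l" by simp
      then have "r \<noteq> y" using ly by simp
      then consider "r \<in> set R1" | "r \<in> set R2" using r R by auto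
      then show False
      proof cases
        case 1
        then have "subseq [r, y] R" unfolding R by (intro subseq_mem_append) auto
        then have "subseq [l, 1, r, y] \<sigma>" using subL[of "[l]" "[r, y]"] l by (simp add: subseq_singleton_left)
        then show False using no3 ly rl gt1[of y] y by (meson UnCI order.strict_trans)
      next
        case 2
        then have "subseq [y, r] R" unfolding R by (intro subseq_drop_many) (simp add: subseq_singleton_left)
        then have "subseq [l, 1, y, r] \<sigma>" using subL[of "[l]" "[y, r]"] l by (simp add: subseq_singleton_left)
        then show False using separableD(2)[OF sep] ly rl gt1[of r] r by blast
      qed
    qed
    \<comment> \<open>For \<open>z\<close> between \<open>l\<close> and 1, either \<open>l\<close>,
      \<open>z\<close>, \<open>1\<close> are three smaller entries before \<open>y\<close>, or
      \<open>l\<close>, \<open>z\<close>, \<open>1\<close>, \<open>y\<close> is a 2413.\<close>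
    have L2: "L2 = []"
    proof (rule ccontr)
      assume "L2 \<noteq> []"
      then obtain z where z: "z \<in> set L2" by (meson last_in_set)
      have "subseq [l, z] L" unfolding L using z by (intro subseq_drop_many) (simp add: subseq_singleton_left)
      then have sub: "subseq [l, z, 1, y] \<sigma>" using subL[of "[l, z]" "[y]"] y by (simp add: subseq_singleton_left)
      have "z \<noteq> y" using dist \<sigma> L z y by auto
      then consider "z < y" | "y < z" by linarith
      then show False
      proof cases
        case 1
        then show ?thesis using no3[OF sub] ly gt1[of y] y by simp
      next
        case 2
        then show ?thesis using separableD(1)[OF sep sub] ly gt1[of l] l by simp
      qed
    qed
    \<comment> \<open>Here the cut just before \<open>l\<close> is used: it yields \<open>a\<close>
      in \<open>L1\<close> below some \<open>b\<close> in \<open>R\<close>, and then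
      \<open>a\<close>, \<open>l\<close>, \<open>1\<close> are three smaller entries before
      \<open>b\<close>.\<close>
    have L1: "L1 = []"
    proof (rule ccontr)
      assume "L1 \<noteq> []"
      have "\<sigma> = L1 @ (l # 1 # R)" using \<sigma> L L2 by simp
      then obtain a b where ab: "a \<in> set L1" "b \<in> set (l # 1 # R)" "a \<le> b"
        by (rule skew_indecomposableE[OF ind]) (use \<open>L1 \<noteq> []\<close> in auto)
      have aL: "a \<in> set L" using ab(1) L by simp
      have "a \<noteq> l" using dist \<sigma> L ab(1) by auto
      then have la: "l < a" using lmin[OF aL] by simp
      then have bR: "b \<in> set R" using ab gt1[of a] aL by auto
      have "a \<noteq> b" using dist \<sigma> aL bR by auto
      then have "a < b" using ab(3) by simp
      have "subseq [a, l] L" unfolding L using ab(1) by (intro subseq_mem_append) auto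
      then have "subseq [a, l, 1, b] \<sigma>" using subL[of "[a, l]" "[b]"] bR by (simp add: subseq_singleton_left)
      then show False using no3 \<open>a < b\<close> la gt1[of b] bR by (meson UnCI order.strict_trans)
    qed
    have s: "\<sigma> = [l, 1] @ R" using \<sigma> L L1 L2 by simp
    have "[l, 1] @ R \<in> perms n" using P s by simp
    then obtain \<beta> where \<beta>: "[l, 1] \<in> perms (length [l, 1])" "\<beta> \<in> perms (length R)"
        "[l, 1] @ R = direct_sum [l, 1] \<beta>"
      by (rule perms_append_less) (use gt1 lR in auto)
    \<comment> \<open>\<open>l\<close> and 1 are exactly the two least values, because both lie
      below all of \<open>R\<close>.\<close>
    have "l \<in> {1..2}" using \<beta>(1) unfolding perms_iff by (auto simp: numeral_2_eq_2)
    then have "l = 2" using gt1[of l] l by simp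
    then have s': "\<sigma> = direct_sum [2, 1] \<beta>" using s \<beta>(3) by simp
    have "bounded_separable 0 \<beta>"
      using bs bounded_separable_direct_sum_21[OF \<beta>(2)] unfolding s' k2 by simp
    moreover have "length R = n - 2" using len s by simp
    ultimately have "\<beta> \<in> bsep 0 (n - 2)" using \<beta>(2) by (simp add: bsep_def)
    moreover have "\<beta> \<noteq> []" using \<beta>(2) y by (auto dest: length_perms)
    ultimately show ?thesis using that(3) k2 s' by blast
  qed
qed

lemma bounded_separable_single: "bounded_separable k [x]"
proof -
  have "length zs \<le> k" if "subseq (zs @ [d]) [x]" for zs d
    using list_emb_length[OF that] by simp
  moreover have "\<not> subseq [a, b, c, d] [x]" for a b c d
    using list_emb_length[of "(=)" "[a, b, c, d]" "[x]"] by auto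
  ultimately show ?thesis
    unfolding bounded_separable_def separable_def smaller_left_bounded_def by blast
qed

text \<open>The conditions \<open>n > 1\<close> and \<open>n > 2\<close> keep the second summand
  nonempty: an empty one would repeat the block \<open>[1]\<close>, or give \<open>[2, 1]\<close>,
  which is skew-decomposable.\<close>

lemma ibsep_eq:
  assumes "k \<le> 2"
  shows "ibsep k n = (if n = 1 then {[1]} else {})
    \<union> (if k > 0 \<and> n > 1 then direct_sum [1] ` bsep (k - 1) (n - 1) else {})
    \<union> (if k = 2 \<and> n > 2 then direct_sum [2, 1] ` bsep 0 (n - 2) else {})"
  (is "_ = ?A \<union> ?B \<union> ?C")
proof (intro equalityI subsetI)
  fix \<sigma> assume "\<sigma> \<in> ibsep k n"
  then have \<sigma>: "\<sigma> \<in> perms n" "bounded_separable k \<sigma>" "skew_indecomposable \<sigma>"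
    by (auto simp: ibsep_def bsep_def)
  from \<sigma> assms show "\<sigma> \<in> ?A \<union> ?B \<union> ?C"
  proof (cases rule: indecomposable_cases)
    case 1
    then show ?thesis using length_perms[OF \<sigma>(1)] by simp
  next
    case (2 j \<beta>)
    then have "length \<beta> = n - 1" "length \<beta> > 0" by (simp_all add: bsep_def length_perms)
    then have "n > 1" by linarith
    then have "\<sigma> \<in> ?B" using 2 by simp
    then show ?thesis by blast
  next
    case (3 \<beta>)
    then have "length \<beta> = n - 2" "length \<beta> > 0" by (simp_all add: bsep_def length_perms)
    then have "n > 2" by linarith
    then have "\<sigma> \<in> ?C" using 3 by simp
    then show ?thesis by blast
  qed
next
  fix \<sigma> assume "\<sigma> \<in> ?A \<union> ?B \<union> ?C"
  then consider "n = 1" "\<sigma> = [1]"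
    | \<beta> where "k > 0" "n > 1" "\<beta> \<in> bsep (k - 1) (n - 1)" "\<sigma> = direct_sum [1] \<beta>"
    | \<beta> where "k = 2" "n > 2" "\<beta> \<in> bsep 0 (n - 2)" "\<sigma> = direct_sum [2, 1] \<beta>"
    by (auto split: if_splits)
  then show "\<sigma> \<in> ibsep k n"
  proof cases
    case 1
    then show ?thesis using perms_1_21(1) bounded_separable_single
      by (auto simp: ibsep_def bsep_def skew_indecomposable_def Cons_eq_append_conv)
  next
    case (2 \<beta>)
    then have \<beta>: "\<beta> \<in> perms (n - 1)" "bounded_separable (k - 1) \<beta>" by (auto simp: bsep_def)
    have "\<beta> \<noteq> []" using length_perms[OF \<beta>(1)] 2 by auto
    then show ?thesis
      using direct_sum_perms[OF perms_1_21(1) \<beta>(1)] direct_sum_indecomposable[OF perms_1_21(1) \<beta>(1)]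
        bounded_separable_direct_sum_1[OF \<beta>(1), of "k - 1"] \<beta>(2) 2
      by (simp add: ibsep_def bsep_def)
  next
    case (3 \<beta>)
    then have \<beta>: "\<beta> \<in> perms (n - 2)" "bounded_separable 0 \<beta>" by (auto simp: bsep_def)
    have "\<beta> \<noteq> []" using length_perms[OF \<beta>(1)] 3 by auto
    moreover have "2 + (n - 2) = n" using 3 by simp
    ultimately show ?thesis
      using direct_sum_perms[OF perms_1_21(2) \<beta>(1)] direct_sum_indecomposable[OF perms_1_21(2) \<beta>(1)]
        bounded_separable_direct_sum_21[OF \<beta>(1)] \<beta>(2) 3
      by (simp add: ibsep_def bsep_def del: add_2_eq_Suc)
  qed
qed

subsection \<open>Generating functions\<close>

definition weight :: "'a::comm_ring_1 \<Rightarrow> 'a \<Rightarrow> 'a \<Rightarrow> 'a \<Rightarrow> 'a \<Rightarrow> 'a \<Rightarrow> nat list \<Rightarrow> 'a" where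
  "weight p q u v s t \<sigma> =
     p ^ asc \<sigma> * q ^ des \<sigma> * u ^ lrmax \<sigma> * v ^ rlmax \<sigma> * s ^ lrmin \<sigma> * t ^ rlmin \<sigma>"

text \<open>The empty permutation is left out, because a skew sum with an empty second summand has
  no descent at the junction and keeps the right-to-left minima of the first.\<close>

definition bsep_fps :: "nat \<Rightarrow> 'a::comm_ring_1 \<Rightarrow> 'a \<Rightarrow> 'a \<Rightarrow> 'a \<Rightarrow> 'a \<Rightarrow> 'a \<Rightarrow> 'a fps" where
  "bsep_fps k p q u v s t = Abs_fps (\<lambda>n. if n = 0 then 0 else \<Sum>\<sigma>\<in>bsep k n. weight p q u v s t \<sigma>)"

definition ibsep_fps :: "nat \<Rightarrow> 'a::comm_ring_1 \<Rightarrow> 'a \<Rightarrow> 'a \<Rightarrow> 'a \<Rightarrow> 'a \<Rightarrow> 'a \<Rightarrow> 'a fps" where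
  "ibsep_fps k p q u v s t = Abs_fps (\<lambda>n. \<Sum>\<sigma>\<in>ibsep k n. weight p q u v s t \<sigma>)"

lemma statistics_Nil [simp]: "lrmax [] = 0" "rlmax [] = 0" "lrmin [] = 0" "rlmin [] = 0"
  by (simp_all add: lrmax_def rlmax_def lrmin_def rlmin_def)

lemma bsep_0: "bsep k 0 = {[]}"
  by (auto simp: bsep_def perms_def bounded_separable_def separable_def smaller_left_bounded_def)

lemma ibsep_0: "ibsep k 0 = {}"
  by (auto simp: ibsep_def bsep_0 skew_indecomposable_def)

lemma F4_eq: "F4 p q u v s t = 1 + bsep_fps 2 p q u v s t"
  by (rule fps_ext) (simp add: F4_def bsep_fps_def S_eq_bsep weight_def bsep_0)

text \<open>Right-to-left minima of the first summand and left-to-right maxima of the second are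
  lost, hence the values 1 for \<open>t\<close> and \<open>u\<close>. The factor \<open>q\<close>
  marks the junction.\<close>

lemma weight_skew_sum:
  assumes "\<alpha> \<in> perms m" "\<beta> \<in> perms n" "\<alpha> \<noteq> []" "\<beta> \<noteq> []"
  shows "weight p q u v s t (skew_sum \<alpha> \<beta>) = q * (weight p q u v s 1 \<alpha> * weight p q 1 v s t \<beta>)"
  using statistics_append_greater[of "map ((+) (length \<beta>)) \<alpha>" \<beta>, OF _ assms(4) skew_sum_greater[OF assms(1,2)]] assms(3)
  by (simp add: skew_sum_def weight_def power_add mult_ac)

text \<open>Here right-to-left maxima of the first summand and left-to-right minima of the second
  are lost, and \<open>p\<close> marks the junction.\<close>

lemma weight_direct_sum:
  assumes "\<alpha> \<in> perms m" "\<beta> \<in> perms n" "\<alpha> \<noteq> []" "\<beta> \<noteq> []"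
  shows "weight p q u v s t (direct_sum \<alpha> \<beta>) = p * (weight p q u 1 s t \<alpha> * weight p q u v 1 t \<beta>)"
  using statistics_append_less[of \<alpha> "map ((+) (length \<alpha>)) \<beta>", OF assms(3) _ direct_sum_less[OF assms(1,2)]] assms(4)
  by (simp add: direct_sum_def weight_def power_add mult_ac)

text \<open>Splitting off the first block: the first term collects the permutations that are a
  single block, the product those with a nonempty remainder.\<close>

lemma bsep_fps_skew_recursion:
  "bsep_fps k p q u v s t =
     ibsep_fps k p q u v s t + fps_const q * (ibsep_fps k p q u v s 1 * bsep_fps k p q 1 v s t)"
proof (rule fps_ext)
  fix n
  let ?I = "ibsep_fps k p q u v s 1" and ?E = "bsep_fps k p q 1 v s t"
  show "bsep_fps k p q u v s t $ n =
    (ibsep_fps k p q u v s t + fps_const q * (?I * ?E)) $ n"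
  proof (cases "n = 0")
    case True
    then show ?thesis by (simp add: bsep_fps_def ibsep_fps_def ibsep_0)
  next
    case False
    have "bsep_fps k p q u v s t $ n =
        (\<Sum>(m, \<alpha>, \<beta>)\<in>(SIGMA m:{1..n}. ibsep k m \<times> bsep k (n - m)). weight p q u v s t (skew_sum \<alpha> \<beta>))"
      using sum.reindex_bij_betw[OF skew_sum_bij[of n k], of "weight p q u v s t"] False
      by (simp add: bsep_fps_def case_prod_unfold)
    also have "\<dots> = (\<Sum>m=1..n. \<Sum>(\<alpha>, \<beta>)\<in>ibsep k m \<times> bsep k (n - m). weight p q u v s t (skew_sum \<alpha> \<beta>))"
      by (subst sum.Sigma) (auto intro!: sum.cong)
    also have "\<dots> = (\<Sum>\<alpha>\<in>ibsep k n. weight p q u v s t \<alpha>) +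
        (\<Sum>m=1..<n. \<Sum>(\<alpha>, \<beta>)\<in>ibsep k m \<times> bsep k (n - m). weight p q u v s t (skew_sum \<alpha> \<beta>))"
    proof -
      \<comment> \<open>The summand \<open>m = n\<close> has \<beta> empty, so its skew sum is the
        block itself with unchanged weight.\<close>
      have "{1..n} = insert n {1..<n}" using False by auto
      then show ?thesis
        by (simp add: bsep_0 sum.cartesian_product[symmetric] skew_sum_def map_idI)
    qed
    also have "(\<Sum>m=1..<n. \<Sum>(\<alpha>, \<beta>)\<in>ibsep k m \<times> bsep k (n - m). weight p q u v s t (skew_sum \<alpha> \<beta>))
        = (\<Sum>m=1..<n. q * (?I $ m * ?E $ (n - m)))"
    proof (rule sum.cong)
      fix m assume m: "m \<in> {1..<n}"
      have "weight p q u v s t (skew_sum \<alpha> \<beta>) = q * (weight p q u v s 1 \<alpha> * weight p q 1 v s t \<beta>)"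
        if "\<alpha> \<in> ibsep k m" "\<beta> \<in> bsep k (n - m)" for \<alpha> \<beta>
      proof -
        have P: "\<alpha> \<in> perms m" "\<beta> \<in> perms (n - m)" using that by (auto simp: ibsep_def bsep_def)
        have "\<alpha> \<noteq> []" "\<beta> \<noteq> []" using length_perms[OF P(1)] length_perms[OF P(2)] m by auto
        then show ?thesis using weight_skew_sum[OF P] by blast
      qed
      then have "(\<Sum>(\<alpha>, \<beta>)\<in>ibsep k m \<times> bsep k (n - m). weight p q u v s t (skew_sum \<alpha> \<beta>)) =
          (\<Sum>(\<alpha>, \<beta>)\<in>ibsep k m \<times> bsep k (n - m). q * (weight p q u v s 1 \<alpha> * weight p q 1 v s t \<beta>))"
        by (intro sum.cong) auto
      also have "\<dots> = q * (?I $ m * ?E $ (n - m))"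
        using m by (simp add: ibsep_fps_def bsep_fps_def sum.cartesian_product[symmetric]
            sum_distrib_left[symmetric] sum_distrib_right[symmetric])
      finally show "(\<Sum>(\<alpha>, \<beta>)\<in>ibsep k m \<times> bsep k (n - m). weight p q u v s t (skew_sum \<alpha> \<beta>)) =
          q * (?I $ m * ?E $ (n - m))" .
    qed simp
    \<comment> \<open>The added summands \<open>m = 0\<close> and \<open>m = n\<close> vanish, since
      both series have constant term 0; this completes the Cauchy product.\<close>
    also have "\<dots> = (\<Sum>m=0..n. q * (?I $ m * ?E $ (n - m)))"
      by (rule sum.mono_neutral_left)
        (auto simp: ibsep_fps_def bsep_fps_def ibsep_0 not_le dest: le_neq_implies_less)
    also have "\<dots> = (fps_const q * (?I * ?E)) $ n"
      by (simp only: fps_mult_left_const_nth fps_mult_nth[of ?I ?E] sum_distrib_left)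
    finally show ?thesis by (simp add: ibsep_fps_def)
  qed
qed

lemma direct_sum_inj: "inj_on (direct_sum \<alpha>) A"
  by (auto simp: inj_on_def direct_sum_def)

lemma sum_weight_direct_sum:
  assumes "\<alpha> \<in> perms m" "\<alpha> \<noteq> []" "n > 0"
  shows "sum (weight p q u v s t) (direct_sum \<alpha> ` bsep k n) =
    p * weight p q u 1 s t \<alpha> * bsep_fps k p q u v 1 t $ n"
proof -
  have "sum (weight p q u v s t) (direct_sum \<alpha> ` bsep k n) =
      (\<Sum>\<beta>\<in>bsep k n. weight p q u v s t (direct_sum \<alpha> \<beta>))"
    by (simp add: sum.reindex[OF direct_sum_inj])
  also have "\<dots> = (\<Sum>\<beta>\<in>bsep k n. p * weight p q u 1 s t \<alpha> * weight p q u v 1 t \<beta>)"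
  proof (rule sum.cong)
    fix \<beta> assume "\<beta> \<in> bsep k n"
    then have \<beta>: "\<beta> \<in> perms n" by (simp add: bsep_def)
    have "\<beta> \<noteq> []" using length_perms[OF \<beta>] assms(3) by auto
    then show "weight p q u v s t (direct_sum \<alpha> \<beta>) = p * weight p q u 1 s t \<alpha> * weight p q u v 1 t \<beta>"
      using weight_direct_sum[OF assms(1) \<beta> assms(2)] by (simp add: mult.assoc)
  qed simp
  finally show ?thesis using assms(3) by (simp add: bsep_fps_def sum_distrib_left)
qed

lemma weight_1: "weight p q u v s t [x] = u * v * s * t"
  by (simp add: weight_def)

lemma weight_21: "weight p q u 1 s t [2, 1] = q * u * s\<^sup>2 * t"
  using statistics_append_greater[of "[2]" "[1]"]
  by (simp add: weight_def power2_eq_square mult_ac)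

lemma ibsep_fps_nth:
  assumes "k \<le> 2"
  shows "ibsep_fps k p q u v s t $ n = (if n = 1 then u * v * s * t else 0)
    + (if k > 0 \<and> n > 1 then p * (u * s * t) * bsep_fps (k - 1) p q u v 1 t $ (n - 1) else 0)
    + (if k = 2 \<and> n > 2 then p * (q * u * s\<^sup>2 * t) * bsep_fps 0 p q u v 1 t $ (n - 2) else 0)"
proof -
  let ?A = "if n = 1 then {[1::nat]} else {}"
  let ?B = "if k > 0 \<and> n > 1 then direct_sum [1] ` bsep (k - 1) (n - 1) else {}"
  let ?C = "if k = 2 \<and> n > 2 then direct_sum [2, 1] ` bsep 0 (n - 2) else {}"
  let ?w = "weight p q u v s t"
  have "ibsep_fps k p q u v s t $ n = sum ?w (?A \<union> ?B \<union> ?C)"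
    by (simp add: ibsep_fps_def ibsep_eq[OF assms])
  \<comment> \<open>Members of \<open>?C\<close> begin with 2, those of \<open>?A\<close> and
    \<open>?B\<close> with 1; \<open>?A\<close> and \<open>?B\<close> are not both nonempty for the
    same \<open>n\<close>.\<close>
  also have "\<dots> = sum ?w (?A \<union> ?B) + sum ?w ?C"
    by (rule sum.union_disjoint) (auto simp: direct_sum_def split: if_splits)
  also have "sum ?w (?A \<union> ?B) = sum ?w ?A + sum ?w ?B"
    by (rule sum.union_disjoint) (auto split: if_splits)
  finally show ?thesis
    using sum_weight_direct_sum[OF perms_1_21(1), of "n - 1" p q u v s t "k - 1"]
      sum_weight_direct_sum[OF perms_1_21(2), of "n - 2" p q u v s t 0]
    by (cases "k = 2") (simp_all add: weight_1 weight_21[simplified])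
qed

section \<open>The series for bounds 0, 1 and 2\<close>

lemma bsep_fps_nth_0 [simp]: "bsep_fps k p q u v s t $ 0 = 0"
  by (simp add: bsep_fps_def)

lemma ibsep_fps_0: "ibsep_fps 0 p q u v s t = fps_const (u * v * s * t) * fps_X"
  by (rule fps_ext) (simp add: ibsep_fps_nth)

lemma ibsep_fps_1: "ibsep_fps 1 p q u v s t = fps_const (u * v * s * t) * fps_X
    + fps_const (p * (u * s * t)) * (fps_X * bsep_fps 0 p q u v 1 t)"
  by (rule fps_ext) (auto simp: ibsep_fps_nth not_less le_Suc_eq)

text \<open>The conditions \<open>n > 1\<close> and \<open>n > 2\<close> on coefficients disappear
  because \<open>bsep_fps\<close> has constant term 0. The three terms come from the blocks 1, those
  with 1 in front, and those with 21 in front.\<close>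

lemma ibsep_fps_2: "ibsep_fps 2 p q u v s t = fps_const (u * v * s * t) * fps_X
    + fps_const (p * (u * s * t)) * (fps_X * bsep_fps 1 p q u v 1 t)
    + fps_const (p * (q * u * s\<^sup>2 * t)) * (fps_X * (fps_X * bsep_fps 0 p q u v 1 t))"
proof (rule fps_ext)
  fix n :: nat
  consider "n = 0" | "n = 1" | "n = 2" | "n > 2" by linarith
  then show "ibsep_fps 2 p q u v s t $ n = (fps_const (u * v * s * t) * fps_X
    + fps_const (p * (u * s * t)) * (fps_X * bsep_fps 1 p q u v 1 t)
    + fps_const (p * (q * u * s\<^sup>2 * t)) * (fps_X * (fps_X * bsep_fps 0 p q u v 1 t))) $ n"
    by cases (simp_all add: ibsep_fps_nth numeral_2_eq_2)
qed

text \<open>The recursion at \<open>u = 1\<close> is a linear equation for the series itself; its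
  solution is inserted for general \<open>u\<close>. Denominators stay cleared, so that ring
  reasoning suffices. Only \<open>s = 1\<close> is treated, as the summand behind 1 or 21 adds no
  left-to-right minima.\<close>

lemma bsep_fps_0_eq:
  fixes p q u v t :: "'a::field"
  defines "x \<equiv> fps_X :: 'a fps" and "Q \<equiv> fps_const q"
    and "U \<equiv> fps_const u" and "V \<equiv> fps_const v" and "T \<equiv> fps_const t"
  defines "d \<equiv> 1 - Q * V * x"
  shows "bsep_fps 0 p q u v 1 t * d = x * U * V * T"
proof -
  have rec: "bsep_fps 0 p q a v 1 t =
      x * fps_const a * V * T + Q * (x * fps_const a * V * bsep_fps 0 p q 1 v 1 t)" for a
    by (subst bsep_fps_skew_recursion)
      (simp add: ibsep_fps_0 x_def Q_def V_def T_def mult_ac flip: fps_const_mult)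
  from rec[of 1] have "bsep_fps 0 p q 1 v 1 t = x * V * T + Q * (x * V * bsep_fps 0 p q 1 v 1 t)"
    by simp
  with rec[of u] show ?thesis unfolding d_def U_def[symmetric] by algebra
qed

text \<open>\<open>e\<close> is \<open>d\<close> times \<open>1 - Q * B\<close>, where
  \<open>B\<close> is the series of blocks for bound 1 at \<open>u = t = 1\<close>. This factor is
  the denominator in the equation for \<open>u = 1\<close>.\<close>

lemma bsep_fps_1_eq:
  fixes p q u v t :: "'a::field"
  defines "x \<equiv> fps_X :: 'a fps" and "P \<equiv> fps_const p" and "Q \<equiv> fps_const q"
    and "U \<equiv> fps_const u" and "V \<equiv> fps_const v" and "T \<equiv> fps_const t"
  defines "d \<equiv> 1 - Q * V * x"
  defines "e \<equiv> d - Q * V * x * (d + P * x)"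
  shows "bsep_fps 1 p q u v 1 t * (d * e) =
    x * U * V * T * ((d + P * x * U * T) * e + Q * V * x * (d + P * x * U) * (d + P * x * T))"
proof -
  have i: "ibsep_fps 1 p q a v 1 b * d =
      x * fps_const a * V * fps_const b * (d + P * x * fps_const a * fps_const b)" for a b
  proof -
    have "ibsep_fps 1 p q a v 1 b = x * fps_const a * V * fps_const b
        + P * fps_const a * fps_const b * x * bsep_fps 0 p q a v 1 b"
      unfolding ibsep_fps_1 by (simp add: x_def P_def V_def mult_ac flip: fps_const_mult)
    moreover have "bsep_fps 0 p q a v 1 b * d = x * fps_const a * V * fps_const b"
      using bsep_fps_0_eq[of p q a v b] by (simp add: x_def V_def Q_def d_def)
    ultimately show ?thesis by algebra
  qed
  have r: "bsep_fps 1 p q a v 1 t = ibsep_fps 1 p q a v 1 t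
      + Q * (ibsep_fps 1 p q a v 1 1 * bsep_fps 1 p q 1 v 1 t)" for a
    unfolding Q_def by (rule bsep_fps_skew_recursion)
  have "bsep_fps 1 p q 1 v 1 t * e = x * V * T * (d + P * x * T)"
    using r[of 1] i[of 1 t] i[of 1 1] unfolding e_def T_def[symmetric] fps_const_1_eq_1 by algebra
  with r[of u] i[of u t] i[of u 1] show ?thesis
    unfolding U_def[symmetric] T_def[symmetric] fps_const_1_eq_1 by algebra
qed

text \<open>\<open>n\<close> and \<open>m\<close> are, up to monomial factors, the numerators over
  \<open>d * e\<close> of all nonempty permutations for bound 1 and of the blocks for bound 2. The
  first part recognises \<open>Fb\<close> as \<open>d * e\<close> times 1 minus \<open>q\<close>
  times the block series at \<open>u = t = 1\<close>; the second says that \<open>d * e\<close>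
  cancels from the resulting numerator.\<close>

lemma rational_identity:
  fixes x p q u v s t :: "'a::idom"
  defines "d \<equiv> 1 - q * v * x"
  defines "e \<equiv> d - q * v * x * (d + p * x)"
  defines "n \<equiv> \<lambda>u t. (d + p * x * u * t) * e + q * v * x * (d + p * x * u) * (d + p * x * t)"
  defines "m \<equiv> \<lambda>u t. d * e + p * x * u * t * n u t + p * q * x^2 * s * u * t * e"
  shows "Fb x p q v s = d * e - q * x * v * s * m 1 1" (is ?A)
    and "d * e * (Fa x p q u v s t - Fb x p q v s) =
      x * u * v * s * t * (m u t * Fb x p q v s + q * x * v * s * m u 1 * m 1 t)" (is ?B)
proof -
  show ?A unfolding m_def n_def e_def d_def Fb_def by algebra
  show ?B unfolding m_def n_def e_def d_def Fb_def Fa_def by algebra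
qed

theorem theorem2p3:
  fixes p q u v s t :: "'a::field"
  shows "F4 p q u v s t =
    Fa fps_X (fps_const p) (fps_const q) (fps_const u) (fps_const v) (fps_const s) (fps_const t) /
    Fb fps_X (fps_const p) (fps_const q) (fps_const v) (fps_const s)"
proof -
  define x where "x = (fps_X :: 'a fps)"
  define P where "P = fps_const p" define Q where "Q = fps_const q"
  define U where "U = fps_const u" define V where "V = fps_const v"
  define R where "R = fps_const s" define T where "T = fps_const t"
  define d where "d = 1 - Q * V * x"
  define e where "e = d - Q * V * x * (d + P * x)"
  define n where "n U T = (d + P * x * U * T) * e + Q * V * x * (d + P * x * U) * (d + P * x * T)" for U T
  define m where "m U T = d * e + P * x * U * T * n U T + P * Q * x^2 * R * U * T * e" for U T
  define A where "A = Fa x P Q U V R T"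
  define B where "B = Fb x P Q V R"
  have B: "B = d * e - Q * x * V * R * m 1 1"
    and AB: "d * e * (A - B) = x * U * V * R * T * (m U T * B + Q * x * V * R * m U 1 * m 1 T)"
    unfolding A_def B_def m_def n_def e_def d_def by (rule rational_identity)+
  have i: "ibsep_fps 2 p q a v s b * (d * e) =
      x * fps_const a * V * R * fps_const b * m (fps_const a) (fps_const b)" for a b
  proof -
    have "ibsep_fps 2 p q a v s b = x * fps_const a * V * R * fps_const b
        + P * fps_const a * R * fps_const b * x * bsep_fps 1 p q a v 1 b
        + P * Q * fps_const a * R^2 * fps_const b * x^2 * bsep_fps 0 p q a v 1 b"
      unfolding ibsep_fps_2
      by (simp add: x_def P_def Q_def V_def R_def power2_eq_square mult_ac flip: fps_const_mult)
    moreover have "bsep_fps 0 p q a v 1 b * d = x * fps_const a * V * fps_const b"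
      using bsep_fps_0_eq[of p q a v b] by (simp add: x_def V_def Q_def d_def)
    moreover have "bsep_fps 1 p q a v 1 b * (d * e) =
        x * fps_const a * V * fps_const b * n (fps_const a) (fps_const b)"
      using bsep_fps_1_eq[of p q a v b] unfolding x_def V_def Q_def P_def d_def e_def n_def .
    ultimately show ?thesis unfolding m_def by algebra
  qed
  have r: "bsep_fps 2 p q a v s t = ibsep_fps 2 p q a v s t
      + Q * (ibsep_fps 2 p q a v s 1 * bsep_fps 2 p q 1 v s t)" for a
    unfolding Q_def by (rule bsep_fps_skew_recursion)
  \<comment> \<open>The recursion at \<open>u = 1\<close> multiplied by \<open>d * e\<close>: the
    coefficient of the unknown series is then exactly \<open>B\<close>.\<close>
  have "bsep_fps 2 p q 1 v s t * B = x * V * R * T * m 1 T"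
    using r[of 1] i[of 1 t] i[of 1 1] unfolding B T_def[symmetric] fps_const_1_eq_1 by algebra
  with r[of u] i[of u t] i[of u 1]
  have "d * e * (bsep_fps 2 p q u v s t * B) =
      x * U * V * R * T * (m U T * B + Q * x * V * R * m U 1 * m 1 T)"
    unfolding U_def[symmetric] T_def[symmetric] fps_const_1_eq_1 by algebra
  also have "\<dots> = d * e * (A - B)" by (rule AB[symmetric])
  \<comment> \<open>The factor \<open>d * e\<close> may be cancelled, as its constant term is
    1.\<close>
  finally have "bsep_fps 2 p q u v s t * B = A - B"
  proof (rule mult_left_cancel[THEN iffD1, rotated])
    have "(d * e) $ 0 = 1" by (simp add: d_def e_def x_def)
    then show "d * e \<noteq> 0" by auto
  qed
  then have "F4 p q u v s t * B = A" by (simp add: F4_eq algebra_simps)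
  \<comment> \<open>Constant term 1 makes \<open>B\<close> nonzero, so the product equation becomes
    the claimed quotient.\<close>
  moreover have "B $ 0 = 1" by (simp add: B d_def e_def x_def)
  then have "B \<noteq> 0" by auto
  ultimately have "F4 p q u v s t = A / B" by (metis nonzero_mult_div_cancel_right)
  then show ?thesis
    unfolding A_def B_def x_def P_def Q_def U_def V_def R_def T_def .
qed

end
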